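(* Let $\mathfrak{R}$ be an expansion of $(\mathbb{R},<,+,\mid\,)$ by subsets of various $\mathbb{N}^n$ (any number of such sets, with $n$ allowed to vary). (1) Every bounded set definable in $\mathfrak{R}$ is definable in $(\mathbb{R},<,+)$. (2) If $E$ is definable in $\mathfrak{R}$ and connected, then for all $x,y\in E$ there is a path in $E$, definable in $(\mathbb{R},<,+)$, joining $x$ to $y$. (3) $\mathfrak{R}$ is CC.
   Context: $\mathbb{N}$ is the set of nonnegative integers, and $\mid$ denotes the divisibility relation on $\mathbb{N}$, regarded as the set $\{(n,dn) : n,d\in\mathbb{N}\}\subseteq\mathbb{R}^2$. All structures are first-order structures with underlying set $\mathbb{R}$. "Definable" means definable with parameters; definable sets are subsets of $\mathbb{R}^n$ for arbitrary $n$. Each $\mathbb{R}^n$ has its usual topology and subsets carry the subspace topology. A path in $E\subseteq\mathbb{R}^n$ joining $x$ to $y$ is a continuous map $\gamma\colon[a,b]\to\mathbb{R}^n$ on a compact interval with $\gamma(a)=x$, $\gamma(b)=y$ and $\gamma([a,b])\subseteq E$. A structure on $\mathbb{R}$ is CC (component closed) if for every definable set $E$, each connected component of $E$ is definable. *)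

theory Defs
  imports "HOL-Analysis.Analysis" "HOL-Library.More_List"
begin

text \<open>
  The space of \<open>n\<close>-tuples of reals is \<^const>\<open>Euclidean_space\<close> \<open>n\<close>: a tuple is a function
  \<open>x :: nat \<Rightarrow> real\<close> with \<open>x i = 0\<close> for all \<open>i \<ge> n\<close>. Lists of reals are read as such tuples
  through \<open>nth_default 0\<close>.
\<close>

abbreviation Rn :: "nat \<Rightarrow> (nat \<Rightarrow> real) set"
  where "Rn n \<equiv> topspace (Euclidean_space n)"

definition Nn :: "nat \<Rightarrow> (nat \<Rightarrow> real) set"
  where "Nn n = {x \<in> Rn n. \<forall>i<n. x i \<in> \<nat>}"


section \<open>First-order structures on the reals\<close>

text \<open>
  A structure with underlying set \<^typ>\<open>real\<close> is given by its primitive operations and relations,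
  each paired with its arity. A primitive serves as its own symbol.
\<close>

record real_struct =
  ops :: "(nat \<times> ((nat \<Rightarrow> real) \<Rightarrow> real)) set"
  rels :: "(nat \<times> (nat \<Rightarrow> real) set) set"

datatype trm =
    Var nat
  | App "(nat \<Rightarrow> real) \<Rightarrow> real" "trm list"

datatype fm =
    Eq trm trm
  | Rel "(nat \<Rightarrow> real) set" "trm list"
  | Neg fm
  | Conj fm fm
  | Ex nat fm

primrec trm_over :: "real_struct \<Rightarrow> trm \<Rightarrow> bool"
  where
    "trm_over M (Var i) = True"
  | "trm_over M (App f ts) = ((length ts, f) \<in> ops M \<and> list_all (trm_over M) ts)"

primrec fm_over :: "real_struct \<Rightarrow> fm \<Rightarrow> bool"
  where
    "fm_over M (Eq s t) = (trm_over M s \<and> trm_over M t)"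
  | "fm_over M (Rel R ts) = ((length ts, R) \<in> rels M \<and> list_all (trm_over M) ts)"
  | "fm_over M (Neg \<phi>) = fm_over M \<phi>"
  | "fm_over M (Conj \<phi> \<psi>) = (fm_over M \<phi> \<and> fm_over M \<psi>)"
  | "fm_over M (Ex i \<phi>) = fm_over M \<phi>"

primrec val :: "(nat \<Rightarrow> real) \<Rightarrow> trm \<Rightarrow> real"
  where
    "val e (Var i) = e i"
  | "val e (App f ts) = f (nth_default 0 (map (val e) ts))"

primrec sat :: "(nat \<Rightarrow> real) \<Rightarrow> fm \<Rightarrow> bool"
  where
    "sat e (Eq s t) = (val e s = val e t)"
  | "sat e (Rel R ts) = (nth_default 0 (map (val e) ts) \<in> R)"
  | "sat e (Neg \<phi>) = (\<not> sat e \<phi>)"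
  | "sat e (Conj \<phi> \<psi>) = (sat e \<phi> \<and> sat e \<psi>)"
  | "sat e (Ex i \<phi>) = (\<exists>r. sat (e(i := r)) \<phi>)"

text \<open>
  Definability with parameters, for subsets of \<open>n\<close>-space: the variables with index below \<open>n\<close>
  range over the coordinates of a point, and the remaining free variables (finitely many in any
  formula) are interpreted by the parameters \<open>a\<close>.
\<close>

definition definable :: "real_struct \<Rightarrow> nat \<Rightarrow> (nat \<Rightarrow> real) set \<Rightarrow> bool"
  where "definable M n E \<longleftrightarrow>
    (\<exists>\<phi> a. fm_over M \<phi> \<and> E = {x \<in> Rn n. sat (\<lambda>i. if i < n then x i else a i) \<phi>})"

definition expand :: "real_struct \<Rightarrow> (nat \<times> (nat \<Rightarrow> real) set) set \<Rightarrow> real_struct"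
  where "expand M \<A> = M\<lparr>rels := rels M \<union> \<A>\<rparr>"


section \<open>The particular structures\<close>

definition less_rel :: "(nat \<Rightarrow> real) set"
  where "less_rel = {x \<in> Rn 2. x 0 < x 1}"

definition add_op :: "(nat \<Rightarrow> real) \<Rightarrow> real"
  where "add_op x = x 0 + x 1"

definition dvd_rel :: "(nat \<Rightarrow> real) set"
  where "dvd_rel = {nth_default 0 [real n, real (d * n)] | n d. True}"

definition R_less_add :: real_struct
  where "R_less_add = \<lparr>ops = {(2, add_op)}, rels = {(2, less_rel)}\<rparr>"

definition R_less_add_dvd :: real_struct
  where "R_less_add_dvd = \<lparr>ops = {(2, add_op)}, rels = {(2, less_rel), (2, dvd_rel)}\<rparr>"


section \<open>Topological notions\<close>

text \<open>
  Boundedness in the Euclidean norm. The library constant \<^const>\<open>bounded\<close> at type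
  \<^typ>\<open>nat \<Rightarrow> real\<close> refers to a metric for the product topology on all sequences and does not
  express this.
\<close>

definition bounded_in :: "nat \<Rightarrow> (nat \<Rightarrow> real) set \<Rightarrow> bool"
  where "bounded_in n E \<longleftrightarrow> (\<exists>B. \<forall>x\<in>E. L2_set x {..<n} \<le> B)"

definition path_joining ::
    "nat \<Rightarrow> (nat \<Rightarrow> real) set \<Rightarrow> real \<Rightarrow> real \<Rightarrow> (real \<Rightarrow> nat \<Rightarrow> real) \<Rightarrow>
      (nat \<Rightarrow> real) \<Rightarrow> (nat \<Rightarrow> real) \<Rightarrow> bool"
  where "path_joining n E a b \<gamma> x y \<longleftrightarrow>
    a \<le> b \<and> continuous_map (top_of_set {a..b}) (Euclidean_space n) \<gamma> \<and>
    \<gamma> a = x \<and> \<gamma> b = y \<and> \<gamma> ` {a..b} \<subseteq> E"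

text \<open>
  A map is definable if its graph is; \<open>case_nat t (\<gamma> t)\<close> is the tuple \<open>\<gamma> t\<close> with \<open>t\<close> prepended.
  The domain \<open>{a..b}\<close> is not normalised to \<open>{0..1}\<close>, since an affine reparametrisation need not
  be definable in the ordered additive group of reals.
\<close>

definition definable_path ::
    "real_struct \<Rightarrow> nat \<Rightarrow> real \<Rightarrow> real \<Rightarrow> (real \<Rightarrow> nat \<Rightarrow> real) \<Rightarrow> bool"
  where "definable_path M n a b \<gamma> \<longleftrightarrow>
    definable M (Suc n) {case_nat t (\<gamma> t) | t. t \<in> {a..b}}"

definition component_closed :: "real_struct \<Rightarrow> bool"
  where "component_closed M \<longleftrightarrow>
    (\<forall>n E C. definable M n E \<longrightarrow>
      C \<in> connected_components_of (subtopology (Euclidean_space n) E) \<longrightarrow> definable M n C)"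

end

theory Submission
  imports Defs
begin

text \<open>
  Write each real number as the sum of its floor and its fractional part. Since the additional
  predicates concern integers only, Fourier--Motzkin elimination shows that membership of \<open>x\<close> in a
  definable set depends only on the floor of \<open>x\<close> and on the signs of finitely many rational affine
  functions at the fractional part of \<open>x\<close>, the functions being the same for all floors. A definable
  set is therefore a union of cells, which are translates by integer vectors of finitely many convex
  semilinear pieces of the unit cube. A bounded set meets only finitely many of these, which gives (1).

  If \<open>x\<close> satisfies the sign conditions of the cell of \<open>y\<close> up to some functions vanishing at \<open>x\<close>, call
  \<open>x\<close> adjacent to \<open>y\<close>; then \<open>x\<close> and \<open>y\<close> are joined by a polygonal path with rational directions. All
  points near \<open>x\<close> have this property, so the connected components are exactly the classes of the
  relation generated by adjacency, which gives (2). This is reachability in a locally finite graph of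
  cells. For (3), it is expressed by quantifying over finite sets of cells; these can be coded by
  natural numbers because divisibility and addition define multiplication.
\<close>

section \<open>Definable predicates and functions\<close>

text \<open>Two limits of the ordered additive group shape the argument. Only rational multiples of
  a variable are definable there, so slopes and path directions are rational, while constant terms
  are arbitrary parameters. Uniformity over all floors has two sources. A term is a sum of
  variables, so its fractional contribution is bounded and only finitely many integer shifts can
  influence a sign. Rational slopes make the values of an affine function at \<open>x - m\<close>,
  for integral \<open>m\<close>, a discrete set, so one radius around \<open>x\<close> works
  whatever the floor of the nearby point. A chain of cells has no a priori length, so no single
  formula can list its members. Instead \<open>z\<close> belongs to the class of \<open>x\<close>
  iff for some box every coded set that respects adjacency inside the box and contains the cell of
  \<open>x\<close> also contains that of \<open>z\<close>. The box is there because a code controls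
  only finitely many cells, whereas a class may meet infinitely many.\<close>

primrec ren_trm :: "(nat \<Rightarrow> nat) \<Rightarrow> trm \<Rightarrow> trm"
  where
    "ren_trm \<rho> (Var i) = Var (\<rho> i)"
  | "ren_trm \<rho> (App f ts) = App f (map (ren_trm \<rho>) ts)"

primrec ren_fm :: "(nat \<Rightarrow> nat) \<Rightarrow> fm \<Rightarrow> fm"
  where
    "ren_fm \<rho> (Eq s t) = Eq (ren_trm \<rho> s) (ren_trm \<rho> t)"
  | "ren_fm \<rho> (Rel R ts) = Rel R (map (ren_trm \<rho>) ts)"
  | "ren_fm \<rho> (Neg \<phi>) = Neg (ren_fm \<rho> \<phi>)"
  | "ren_fm \<rho> (Conj \<phi> \<psi>) = Conj (ren_fm \<rho> \<phi>) (ren_fm \<rho> \<psi>)"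
  | "ren_fm \<rho> (Ex i \<phi>) = Ex (\<rho> i) (ren_fm \<rho> \<phi>)"

lemma val_ren_trm: "val e (ren_trm \<rho> t) = val (e \<circ> \<rho>) t"
proof (induction t)
  case (App f ts)
  then have "map (val e \<circ> ren_trm \<rho>) ts = map (val (e \<circ> \<rho>)) ts"
    by (simp del: o_apply add: o_apply[of "val e"])
  then show ?case by (simp only: ren_trm.simps val.simps map_map)
qed simp

text \<open>Bound variables are renamed along with the free ones. Injectivity excludes capture: an
  update at \<open>\<rho> i\<close> changes only entry \<open>i\<close> of
  \<open>e \<circ> \<rho>\<close>.\<close>

lemma sat_ren_fm: "inj \<rho> \<Longrightarrow> sat e (ren_fm \<rho> \<phi>) = sat (e \<circ> \<rho>) \<phi>"
proof (induction \<phi> arbitrary: e)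
  case (Rel R ts)
  have "map (val e \<circ> ren_trm \<rho>) ts = map (val (e \<circ> \<rho>)) ts"
    by (simp add: val_ren_trm)
  then show ?case by (simp only: ren_fm.simps sat.simps map_map)
next
  case (Ex i \<phi>)
  have "e(\<rho> i := r) \<circ> \<rho> = (e \<circ> \<rho>)(i := r)" for r
    using \<open>inj \<rho>\<close> by (auto simp: fun_eq_iff inj_eq)
  with Ex show ?case by (simp del: o_apply)
qed (simp_all add: val_ren_trm)

lemma trm_over_ren_trm [simp]: "trm_over M (ren_trm \<rho> t) = trm_over M t"
  by (induction t) (auto simp: list_all_iff)

lemma fm_over_ren_fm [simp]: "fm_over M (ren_fm \<rho> \<phi>) = fm_over M \<phi>"
  by (induction \<phi>) (auto simp: list_all_iff)

definition interleave :: "(nat \<Rightarrow> 'a) \<Rightarrow> (nat \<Rightarrow> 'a) \<Rightarrow> nat \<Rightarrow> 'a"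
  where "interleave e p j = (if even j then e (j div 2) else p (j div 2))"

text \<open>In the defining formula the even variables are the arguments and the odd ones the parameters.\<close>

definition dpred :: "real_struct \<Rightarrow> ((nat \<Rightarrow> real) \<Rightarrow> bool) \<Rightarrow> bool"
  where "dpred M P \<longleftrightarrow> (\<exists>\<phi> p. fm_over M \<phi> \<and> (\<forall>e. P e \<longleftrightarrow> sat (interleave e p) \<phi>))"

lemma dpredI:
  assumes "fm_over M \<phi>" "inj \<rho>" "\<And>e. P e \<longleftrightarrow> sat (interleave e p \<circ> \<rho>) \<phi>"
  shows "dpred M P"
  unfolding dpred_def using assms
  by (intro exI[of _ "ren_fm \<rho> \<phi>"] exI[of _ p]) (simp add: sat_ren_fm)

lemma dpred_inj:
  assumes "dpred M P" "inj f"
  shows "dpred M (\<lambda>e. P (\<lambda>i. e (f i)))"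
proof -
  obtain \<phi> p where \<phi>: "fm_over M \<phi>" "\<And>e. P e \<longleftrightarrow> sat (interleave e p) \<phi>"
    using assms by (auto simp: dpred_def)
  let ?\<rho> = "\<lambda>j. if even j then 2 * f (j div 2) else j"
  have "inj ?\<rho>"
    using assms(2) by (intro injI) (auto split: if_splits simp: inj_eq)
  moreover have "interleave e p \<circ> ?\<rho> = interleave (\<lambda>i. e (f i)) p" for e
    by (auto simp: interleave_def fun_eq_iff)
  ultimately show ?thesis
    using \<phi> by (intro dpredI[where \<rho> = ?\<rho> and p = p and \<phi> = \<phi>]) auto
qed

lemma dpred_not: "dpred M P \<Longrightarrow> dpred M (\<lambda>e. \<not> P e)"
proof -
  assume "dpred M P"
  then obtain \<phi> p where "fm_over M \<phi>" "\<And>e. P e \<longleftrightarrow> sat (interleave e p) \<phi>"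
    by (auto simp: dpred_def)
  then show ?thesis
    unfolding dpred_def by (intro exI[of _ "Neg \<phi>"] exI[of _ p]) simp
qed

lemma dpred_conj:
  assumes "dpred M P" "dpred M Q"
  shows "dpred M (\<lambda>e. P e \<and> Q e)"
proof -
  obtain \<phi> p where \<phi>: "fm_over M \<phi>" "\<And>e. P e \<longleftrightarrow> sat (interleave e p) \<phi>"
    using assms by (auto simp: dpred_def)
  obtain \<psi> q where \<psi>: "fm_over M \<psi>" "\<And>e. Q e \<longleftrightarrow> sat (interleave e q) \<psi>"
    using assms by (auto simp: dpred_def)
  \<comment> \<open>In \<open>interleave e (interleave p q)\<close> entry \<open>k\<close> of
    \<open>p\<close> sits at position 4k+1 and entry \<open>k\<close> of \<open>q\<close> at 4k+3.
    The two formulas thus share their arguments and keep separate parameters.\<close>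
  let ?\<rho> = "\<lambda>j::nat. if even j then j else 4 * (j div 2) + 1"
  let ?\<sigma> = "\<lambda>j::nat. if even j then j else 4 * (j div 2) + 3"
  have inj: "inj ?\<rho>" "inj ?\<sigma>"
    by (intro injI; auto split: if_splits; presburger)+
  have "(interleave e (interleave p q) \<circ> ?\<rho>) j = interleave e p j \<and>
      (interleave e (interleave p q) \<circ> ?\<sigma>) j = interleave e q j" for e j
    by (cases "even j") (auto simp: interleave_def div_add1_eq elim!: oddE)
  then have "interleave e (interleave p q) \<circ> ?\<rho> = interleave e p"
      "interleave e (interleave p q) \<circ> ?\<sigma> = interleave e q" for e
    by blast+
  then show ?thesis
    unfolding dpred_def using \<phi> \<psi> inj
    by (intro exI[of _ "Conj (ren_fm ?\<rho> \<phi>) (ren_fm ?\<sigma> \<psi>)"] exI[of _ "interleave p q"])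
       (simp add: sat_ren_fm)
qed

lemma dpred_ex:
  assumes "dpred M (\<lambda>e. P (e 0) (\<lambda>i. e (Suc i)))"
  shows "dpred M (\<lambda>e. \<exists>r. P r e)"
proof -
  obtain \<phi> p where \<phi>: "fm_over M \<phi>"
      "\<And>e. P (e 0) (\<lambda>i. e (Suc i)) \<longleftrightarrow> sat (interleave e p) \<phi>"
    using assms by (auto simp: dpred_def)
  \<comment> \<open>Argument 0 becomes the bound variable and is moved to position 1, a parameter
    slot vacated by \<open>case_nat 0 p\<close>. The other arguments move down by one place and the
    parameters up by one.\<close>
  let ?\<rho> = "\<lambda>j::nat. if j = 0 then 1 else if even j then j - 2 else j + 2"
  have inj: "inj ?\<rho>"
    by (intro injI; auto split: if_splits; presburger)
  have eq: "(interleave e (case_nat 0 p))(Suc 0 := r) \<circ> ?\<rho> = interleave (case_nat r e) p" for e r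
  proof
    fix j :: nat
    consider "j = 0" | k where "j = 2 * Suc k" | k where "j = 2 * k + 1"
    proof (cases "even j")
      case True
      then obtain l where "j = 2 * l" by blast
      then show ?thesis using that by (cases l) auto
    qed (use that in \<open>blast elim: oddE\<close>)
    then show "((interleave e (case_nat 0 p))(Suc 0 := r) \<circ> ?\<rho>) j = interleave (case_nat r e) p j"
      by cases (simp_all add: interleave_def)
  qed
  have "P r e \<longleftrightarrow> sat (interleave (case_nat r e) p) \<phi>" for r e
    using \<phi>(2)[of "case_nat r e"] by simp
  then show ?thesis
    unfolding dpred_def using \<phi>(1) inj eq
    by (intro exI[of _ "Ex 1 (ren_fm ?\<rho> \<phi>)"] exI[of _ "case_nat 0 p"])
       (simp add: sat_ren_fm)
qed

lemma dpred_disj: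
  assumes "dpred M P" "dpred M Q"
  shows "dpred M (\<lambda>e. P e \<or> Q e)"
  using dpred_not[OF dpred_conj[OF assms[THEN dpred_not]]] by simp

lemma dpred_imp:
  assumes "dpred M P" "dpred M Q"
  shows "dpred M (\<lambda>e. P e \<longrightarrow> Q e)"
  using dpred_disj[OF assms(1)[THEN dpred_not] assms(2)] by (simp only: imp_conv_disj)

lemma dpred_iff:
  assumes "dpred M P" "dpred M Q"
  shows "dpred M (\<lambda>e. P e \<longleftrightarrow> Q e)"
proof -
  have "(\<lambda>e. P e \<longleftrightarrow> Q e) = (\<lambda>e. (P e \<longrightarrow> Q e) \<and> (Q e \<longrightarrow> P e))" by blast
  with dpred_conj[OF dpred_imp[OF assms] dpred_imp[OF assms(2,1)]] show ?thesis by (simp only:)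
qed

lemma dpred_all:
  assumes "dpred M (\<lambda>e. P (e 0) (\<lambda>i. e (Suc i)))"
  shows "dpred M (\<lambda>e. \<forall>r. P r e)"
proof -
  have "dpred M (\<lambda>e. \<exists>r. \<not> P r e)" by (rule dpred_ex) (rule dpred_not[OF assms])
  from dpred_not[OF this] show ?thesis by simp
qed

lemma dpred_sat: "fm_over M \<phi> \<Longrightarrow> dpred M (\<lambda>e. sat e \<phi>)"
proof (erule dpredI)
  show "inj (\<lambda>i::nat. 2 * i)" by (simp add: inj_on_def)
  show "sat e \<phi> \<longleftrightarrow> sat (interleave e (\<lambda>_. 0) \<circ> (\<lambda>i. 2 * i)) \<phi>" for e
    by (simp add: interleave_def comp_def)
qed

lemma dpred_const: "dpred M (\<lambda>e. b)"
proof -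
  have "dpred M (\<lambda>e. sat e (Eq (Var 0) (Var 0)))" by (rule dpred_sat) simp
  then have "dpred M (\<lambda>e. True)" by simp
  with dpred_not[OF this] show ?thesis by (cases b) auto
qed

lemma dpred_eq_const: "dpred M (\<lambda>e. e i = c)"
proof (rule dpredI)
  let ?\<rho> = "\<lambda>j. if j = 0 then 2 * i else 2 * j + 1"
  show "inj ?\<rho>"
    by (intro injI; simp split: if_splits; presburger)
  show "e i = c \<longleftrightarrow> sat (interleave e (\<lambda>_. c) \<circ> ?\<rho>) (Eq (Var 0) (Var 1))" for e
    by (simp add: interleave_def)
qed simp

lemma dpred_eq_var: "dpred M (\<lambda>e. e i = e j)"
  using dpred_sat[of M "Eq (Var i) (Var j)"] by simp

lemma dpred_ball_finite:
  "finite A \<Longrightarrow> (\<And>x. x \<in> A \<Longrightarrow> dpred M (P x)) \<Longrightarrow> dpred M (\<lambda>e. \<forall>x\<in>A. P x e)"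
  by (induction rule: finite_induct) (auto intro!: dpred_conj dpred_const)

lemma dpred_bex_finite:
  "finite A \<Longrightarrow> (\<And>x. x \<in> A \<Longrightarrow> dpred M (P x)) \<Longrightarrow> dpred M (\<lambda>e. \<exists>x\<in>A. P x e)"
  by (induction rule: finite_induct) (auto intro!: dpred_disj dpred_const)

lemma dpred_all_less: "(\<And>i. i < n \<Longrightarrow> dpred M (P i)) \<Longrightarrow> dpred M (\<lambda>e. \<forall>i<n. P i e)" for n :: nat
  using dpred_ball_finite[of "{..<n}" M P] by (simp add: Ball_def)

section \<open>Tuples as truncated sequences, and definable sets\<close>

definition trunc :: "nat \<Rightarrow> (nat \<Rightarrow> real) \<Rightarrow> nat \<Rightarrow> real"
  where "trunc n e = (\<lambda>i. if i < n then e i else 0)"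

lemma Rn_iff: "x \<in> Rn n \<longleftrightarrow> (\<forall>i\<ge>n. x i = 0)"
  by (simp add: topspace_Euclidean_space)

lemma trunc_in_Rn [simp]: "trunc n e \<in> Rn n"
  by (simp add: Rn_iff trunc_def)

lemma trunc_id: "x \<in> Rn n \<Longrightarrow> trunc n x = x"
  by (auto simp: Rn_iff trunc_def fun_eq_iff)

lemma dpred_block_ex:
  assumes "dpred M (\<lambda>e. P (trunc n e) (\<lambda>i. e (n + i)))"
  shows "dpred M (\<lambda>e. \<exists>x\<in>Rn n. P x e)"
  using assms
proof (induction n arbitrary: P)
  case 0
  have "Rn 0 = {\<lambda>_. 0}" "trunc 0 e = (\<lambda>_. 0)" for e
    by (auto simp: Rn_iff trunc_def fun_eq_iff)
  with 0 show ?case by simp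
next
  case (Suc n)
  have "trunc (Suc n) e = case_nat (e 0) (trunc n (\<lambda>i. e (Suc i)))" for e
    by (auto simp: trunc_def fun_eq_iff split: nat.splits)
  with Suc.prems have
    "dpred M (\<lambda>e. P (case_nat (e 0) (trunc n (\<lambda>i. e (Suc i)))) (\<lambda>i. e (Suc (n + i))))"
    by simp
  then have "dpred M (\<lambda>e. \<exists>r. P (case_nat r (trunc n e)) (\<lambda>i. e (n + i)))"
    by (rule dpred_ex)
  from Suc.IH[OF this]
  have "dpred M (\<lambda>e. \<exists>x\<in>Rn n. \<exists>r. P (case_nat r x) e)" .
  moreover have "(\<exists>x\<in>Rn n. \<exists>r. P (case_nat r x) e) \<longleftrightarrow> (\<exists>x\<in>Rn (Suc n). P x e)" for e
  proof safe
    fix x r assume "x \<in> Rn n" "P (case_nat r x) e"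
    then show "\<exists>x\<in>Rn (Suc n). P x e"
      by (intro bexI[of _ "case_nat r x"]) (auto simp: Rn_iff split: nat.splits)
  next
    fix x assume x: "x \<in> Rn (Suc n)" "P x e"
    have "case_nat (x 0) (\<lambda>i. x (Suc i)) = x"
      by (auto simp: fun_eq_iff split: nat.splits)
    with x show "\<exists>x\<in>Rn n. \<exists>r. P (case_nat r x) e"
      by (intro bexI[of _ "\<lambda>i. x (Suc i)"] exI[of _ "x 0"]) (auto simp: Rn_iff)
  qed
  ultimately show ?case by simp
qed

lemma dpred_block_all:
  assumes "dpred M (\<lambda>e. P (trunc n e) (\<lambda>i. e (n + i)))"
  shows "dpred M (\<lambda>e. \<forall>x\<in>Rn n. P x e)"
proof -
  have "dpred M (\<lambda>e. \<exists>x\<in>Rn n. \<not> P x e)" by (rule dpred_block_ex) (rule dpred_not[OF assms])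
  from dpred_not[OF this] show ?thesis by simp
qed

lemma definable_iff_dpred: "definable M n E \<longleftrightarrow> E \<subseteq> Rn n \<and> dpred M (\<lambda>e. trunc n e \<in> E)"
proof
  assume "definable M n E"
  then obtain \<phi> a where \<phi>: "fm_over M \<phi>"
      "E = {x \<in> Rn n. sat (\<lambda>i. if i < n then x i else a i) \<phi>}"
    by (auto simp: definable_def)
  \<comment> \<open>A free variable \<open>i \<ge> n\<close> stands for the parameter
    \<open>a i\<close>, which \<open>interleave e a\<close> holds at position
    \<open>2 * i + 1\<close>.\<close>
  let ?\<rho> = "\<lambda>i. if i < n then 2 * i else 2 * i + 1"
  have "inj ?\<rho>"
    by (intro injI; auto split: if_splits; presburger)
  moreover have "interleave e a \<circ> ?\<rho> = (\<lambda>i. if i < n then e i else a i)" for e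
    by (auto simp: interleave_def fun_eq_iff)
  moreover have "(\<lambda>i. if i < n then trunc n e i else a i) = (\<lambda>i. if i < n then e i else a i)" for e
    by (auto simp: trunc_def fun_eq_iff)
  ultimately show "E \<subseteq> Rn n \<and> dpred M (\<lambda>e. trunc n e \<in> E)"
    using \<phi> by (auto intro!: dpredI[where \<rho> = ?\<rho> and p = a and \<phi> = \<phi>])
next
  assume E: "E \<subseteq> Rn n \<and> dpred M (\<lambda>e. trunc n e \<in> E)"
  then obtain \<phi> p where \<phi>: "fm_over M \<phi>" "\<And>e. trunc n e \<in> E \<longleftrightarrow> sat (interleave e p) \<phi>"
    by (auto simp: dpred_def)
  \<comment> \<open>The first \<open>n\<close> arguments become the coordinates; every other
    variable moves up by \<open>n\<close> and becomes a parameter. The even ones among these are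
    arguments beyond the tuple, where \<open>trunc\<close> gives 0; hence the zero sequence in
    \<open>?a\<close>.\<close>
  let ?\<rho> = "\<lambda>j. if even j \<and> j < 2 * n then j div 2 else n + j"
  let ?a = "\<lambda>i. interleave (\<lambda>_. 0) p (i - n)"
  have inj: "inj ?\<rho>"
    by (intro injI; auto split: if_splits; presburger)
  have "(\<lambda>i. if i < n then x i else ?a i) \<circ> ?\<rho> = interleave (trunc n x) p" for x
    by (auto simp: interleave_def fun_eq_iff trunc_def)
  then have "sat (\<lambda>i. if i < n then x i else ?a i) (ren_fm ?\<rho> \<phi>) \<longleftrightarrow> trunc n x \<in> E" for x
    using \<phi>(2)[of "trunc n x"] inj by (simp add: sat_ren_fm trunc_id)
  with E have "E = {x \<in> Rn n. sat (\<lambda>i. if i < n then x i else ?a i) (ren_fm ?\<rho> \<phi>)}"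
    by (auto simp: trunc_id)
  with \<phi>(1) show "definable M n E"
    unfolding definable_def
    by (intro exI[of _ "ren_fm ?\<rho> \<phi>"] exI[of _ ?a]) auto
qed

section \<open>Definable functions and substitution\<close>

definition dfun :: "real_struct \<Rightarrow> ((nat \<Rightarrow> real) \<Rightarrow> real) \<Rightarrow> bool"
  where "dfun M t \<longleftrightarrow> dpred M (\<lambda>e. e 0 = t (\<lambda>i. e (Suc i)))"

lemma dfun_inj:
  assumes "dfun M t" "inj f"
  shows "dfun M (\<lambda>e. t (\<lambda>i. e (f i)))"
proof -
  have "inj (case_nat 0 (\<lambda>i. Suc (f i)))"
    using assms(2) by (intro injI) (auto simp: inj_eq split: nat.splits)
  from dpred_inj[OF assms(1)[unfolded dfun_def] this] show ?thesis
    by (simp add: dfun_def)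
qed

lemma dfun_Suc: "dfun M t \<Longrightarrow> dfun M (\<lambda>e. t (\<lambda>i. e (Suc i)))"
  by (erule dfun_inj) simp

lemma dpred_Suc: "dpred M P \<Longrightarrow> dpred M (\<lambda>e. P (\<lambda>i. e (Suc i)))"
  by (erule dpred_inj) simp

lemma dpred_subst:
  assumes "dpred M (\<lambda>e. P (e 0) (\<lambda>i. e (Suc i)))" "dfun M t"
  shows "dpred M (\<lambda>e. P (t e) e)"
proof -
  have "dpred M (\<lambda>e. \<exists>r. r = t e \<and> P r e)"
    by (rule dpred_ex, rule dpred_conj) (use assms in \<open>auto simp: dfun_def\<close>)
  then show ?thesis by simp
qed

lemma dpred_subst2:
  assumes "\<And>i j. dpred M (\<lambda>e. R (e i) (e j))" "dfun M s" "dfun M t"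
  shows "dpred M (\<lambda>e. R (s e) (t e))"
proof (rule dpred_subst[OF _ assms(2)], rule dpred_subst[OF _ dfun_Suc[OF assms(3)]])
  show "dpred M (\<lambda>e. R (e (Suc 0)) (e 0))" by (rule assms)
qed

lemma dfun_var: "dfun M (\<lambda>e. e i)"
  by (simp add: dfun_def dpred_eq_var)

lemma dfun_const: "dfun M (\<lambda>e. c)"
  by (simp add: dfun_def dpred_eq_const)

lemma dpred_eq: "dfun M s \<Longrightarrow> dfun M t \<Longrightarrow> dpred M (\<lambda>e. s e = t e)"
  by (rule dpred_subst2[where R = "(=)"]) (rule dpred_eq_var)

lemma dfunI:
  assumes "dpred M (\<lambda>e. P (e 0) (\<lambda>i. e (Suc i)))" "\<And>e r. r = t e \<longleftrightarrow> P r e"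
  shows "dfun M t"
  unfolding dfun_def assms(2) by (rule assms(1))

lemma dfun_if:
  assumes "dpred M P" "dfun M s" "dfun M t"
  shows "dfun M (\<lambda>e. if P e then s e else t e)"
  by (rule dfunI[where P = "\<lambda>r e. (P e \<and> r = s e) \<or> (\<not> P e \<and> r = t e)"])
     (auto intro!: dpred_disj dpred_conj dpred_not dpred_eq dpred_Suc dfun_Suc dfun_var assms)

lemma dpred_subst3:
  assumes "\<And>i j k. dpred M (\<lambda>e. R (e i) (e j) (e k))" "dfun M r" "dfun M s" "dfun M t"
  shows "dpred M (\<lambda>e. R (r e) (s e) (t e))"
proof (rule dpred_subst[OF _ assms(2)], rule dpred_subst[OF _ dfun_Suc[OF assms(3)]],
    rule dpred_subst[OF _ dfun_Suc[OF dfun_Suc[OF assms(4)]]])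
  show "dpred M (\<lambda>e. R (e (Suc (Suc 0))) (e (Suc 0)) (e 0))" by (rule assms)
qed

section \<open>Arithmetic available from order and addition\<close>

locale ordered_group_struct =
  fixes M :: real_struct
  assumes add_op_in: "(2, add_op) \<in> ops M"
    and less_rel_in: "(2, less_rel) \<in> rels M"
begin

lemma dpred_less: "dfun M s \<Longrightarrow> dfun M t \<Longrightarrow> dpred M (\<lambda>e. s e < t e)"
proof (rule dpred_subst2[where R = "(<)"])
  show "dpred M (\<lambda>e. e i < e j)" for i j
    using dpred_sat[of M "Rel less_rel [Var i, Var j]"] less_rel_in
    by (simp add: less_rel_def Rn_iff numeral_2_eq_2 nth_default_beyond)
qed

lemma dpred_le: "dfun M s \<Longrightarrow> dfun M t \<Longrightarrow> dpred M (\<lambda>e. s e \<le> t e)"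
  using dpred_not[OF dpred_less[of t s]] by (simp add: not_less)

lemma dfun_add:
  assumes "dfun M s" "dfun M t"
  shows "dfun M (\<lambda>e. s e + t e)"
proof -
  have "dpred M (\<lambda>e. e i = e j + e k)" for i j k
    using dpred_sat[of M "Eq (Var i) (App add_op [Var j, Var k])"] add_op_in
    by (simp add: add_op_def numeral_2_eq_2)
  from dpred_subst3[of M "\<lambda>x y z. x = y + z", OF this dfun_var dfun_Suc[OF assms(1)] dfun_Suc[OF assms(2)]]
  show ?thesis unfolding dfun_def .
qed

lemma dfun_uminus:
  assumes "dfun M t"
  shows "dfun M (\<lambda>e. - t e)"
proof (rule dfunI)
  show "dpred M (\<lambda>e. e 0 + t (\<lambda>i. e (Suc i)) = 0)"
    by (rule dpred_eq[OF dfun_add[OF dfun_var dfun_Suc[OF assms]] dfun_const])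
qed auto

lemma dfun_diff: "dfun M s \<Longrightarrow> dfun M t \<Longrightarrow> dfun M (\<lambda>e. s e - t e)"
  using dfun_add[OF _ dfun_uminus, of s t] by simp

lemma dfun_of_nat_scale: "dfun M t \<Longrightarrow> dfun M (\<lambda>e. real k * t e)"
proof (induction k)
  case (Suc k)
  then show ?case using dfun_add[of t "\<lambda>e. real k * t e"] by (simp add: algebra_simps)
qed (simp add: dfun_const)

lemma dfun_of_int_scale: "dfun M t \<Longrightarrow> dfun M (\<lambda>e. real_of_int k * t e)"
  using dfun_of_nat_scale[of t "nat k"] dfun_uminus[OF dfun_of_nat_scale[of t "nat (- k)"]]
  by (cases "k \<ge> 0") auto

text \<open>Repeated addition gives integer multiples, and the denominator is moved to the other
  side of the equation defining the graph.\<close>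

lemma dfun_rat_scale:
  assumes "q \<in> \<rat>" "dfun M t"
  shows "dfun M (\<lambda>e. q * t e)"
proof -
  obtain i n where q: "q = real_of_int i / real n" "n \<noteq> 0"
    using assms(1) by (auto simp: Rats_eq_int_div_nat)
  show ?thesis
  proof (rule dfunI)
    show "dpred M (\<lambda>e. real n * e 0 = real_of_int i * t (\<lambda>i. e (Suc i)))"
      by (rule dpred_eq[OF dfun_of_nat_scale[OF dfun_var] dfun_of_int_scale[OF dfun_Suc[OF assms(2)]]])
    have "real_of_int i * t e = real n * (q * t e)" for e
      using q by simp
    then show "r = q * t e \<longleftrightarrow> real n * r = real_of_int i * t e" for r e
      using q(2) by (metis mult_cancel_left of_nat_eq_0_iff)
  qed
qed

lemma dfun_sgn:
  assumes "dfun M t"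
  shows "dfun M (\<lambda>e. sgn (t e))"
proof -
  have "dfun M (\<lambda>e. if 0 < t e then 1 else if t e < 0 then - 1 else 0)"
    by (intro dfun_if dpred_less dfun_const assms)
  moreover have "(\<lambda>e. if 0 < t e then 1 else if t e < 0 then - 1 else 0) = (\<lambda>e. sgn (t e))"
    by (auto simp: sgn_real_def)
  ultimately show ?thesis by simp
qed

end

section \<open>Definable sets as unions of cells\<close>

text \<open>Coefficients are rational so that these functions are definable from addition alone; the
  constant term may be any real because parameters are allowed.\<close>

inductive aff :: "((nat \<Rightarrow> real) \<Rightarrow> real) \<Rightarrow> bool"
  where
    aff_const: "aff (\<lambda>x. c)"
  | aff_var: "aff (\<lambda>x. x i)"
  | aff_add: "aff f \<Longrightarrow> aff g \<Longrightarrow> aff (\<lambda>x. f x + g x)"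
  | aff_scale: "q \<in> \<rat> \<Longrightarrow> aff f \<Longrightarrow> aff (\<lambda>x. q * f x)"

lemma (in ordered_group_struct) dfun_aff:
  "aff h \<Longrightarrow> (\<And>i. dfun M (\<lambda>e. v e i)) \<Longrightarrow> dfun M (\<lambda>e. h (v e))"
  by (induction rule: aff.induct) (auto intro: dfun_const dfun_add dfun_rat_scale)

lemma aff_diff: "aff f \<Longrightarrow> aff g \<Longrightarrow> aff (\<lambda>x. f x - g x)"
  using aff_add[of f "\<lambda>x. - 1 * g x"] aff_scale[of "- 1" g] by simp

lemma aff_subst: "aff h \<Longrightarrow> (\<And>i. aff (\<lambda>x. v x i)) \<Longrightarrow> aff (\<lambda>x. h (v x))"
  by (induction rule: aff.induct) (auto intro: aff.intros)

lemma aff_upd_const: "aff h \<Longrightarrow> aff (\<lambda>x. h (x(i := c)))"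
  by (erule aff_subst, rename_tac j, case_tac "j = i") (auto intro: aff.intros)

lemma aff_slope:
  assumes "aff h"
  shows "\<exists>q\<in>\<rat>. \<forall>x t. h (x(i := t)) = h (x(i := 0)) + q * t"
  using assms
proof induction
  case (aff_const c)
  show ?case by (rule bexI[of _ 0]) auto
next
  case (aff_var j)
  show ?case by (rule bexI[of _ "if i = j then 1 else 0"]) auto
next
  case (aff_add f g)
  obtain p where p: "p \<in> \<rat>" "\<And>x t. f (x(i := t)) = f (x(i := 0)) + p * t"
    using aff_add.IH(1) by blast
  obtain q where q: "q \<in> \<rat>" "\<And>x t. g (x(i := t)) = g (x(i := 0)) + q * t"
    using aff_add.IH(2) by blast
  have "f (x(i := t)) + g (x(i := t)) = f (x(i := 0)) + g (x(i := 0)) + (p + q) * t" for x t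
    using p(2)[of x t] q(2)[of x t] by (simp only: distrib_right add_ac)
  then show ?case using Rats_add[OF p(1) q(1)] by blast
next
  case (aff_scale p f)
  then obtain q where "q \<in> \<rat>" "\<And>x t. f (x(i := t)) = f (x(i := 0)) + q * t"
    by blast
  then have "p * f (x(i := t)) = p * f (x(i := 0)) + p * q * t" for x t
    by (metis distrib_left mult.assoc)
  then show ?case using Rats_mult[OF aff_scale(1) \<open>q \<in> \<rat>\<close>] by blast
qed

text \<open>The difference \<open>h w - h (\<lambda>_. 0)\<close> is the linear part of
  \<open>h\<close> evaluated at \<open>w\<close>; it is written this way throughout.\<close>

lemma aff_line:
  "aff h \<Longrightarrow> h (\<lambda>i. x i + c * w i) = h x + c * (h w - h (\<lambda>_. 0))"
proof (induction rule: aff.induct)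
  case (aff_scale q f)
  show ?case unfolding aff_scale.IH by (simp add: algebra_simps)
qed (simp_all add: algebra_simps)

lemma aff_diff_Rats:
  "aff h \<Longrightarrow> (\<And>i. w i \<in> \<rat>) \<Longrightarrow> h w - h (\<lambda>_. 0) \<in> \<rat>"
proof (induction rule: aff.induct)
  case (aff_add f g)
  have "(f w - f (\<lambda>_. 0)) + (g w - g (\<lambda>_. 0)) \<in> \<rat>"
    by (rule Rats_add[OF aff_add.IH]) (rule aff_add.prems)+
  then show ?case by (simp add: algebra_simps)
next
  case (aff_scale q f)
  have "q * (f w - f (\<lambda>_. 0)) \<in> \<rat>"
    by (rule Rats_mult[OF aff_scale.hyps(1) aff_scale.IH]) (rule aff_scale.prems)
  then show ?case by (simp add: algebra_simps)
qed auto

lemma aff_lipschitz: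
  assumes "aff h"
  shows "\<exists>K\<ge>0. \<forall>x y d. (\<forall>i. \<bar>x i - y i\<bar> \<le> d) \<longrightarrow> \<bar>h x - h y\<bar> \<le> K * d"
  using assms
proof induction
  case (aff_const c)
  show ?case by (rule exI[of _ 0]) auto
next
  case (aff_var j)
  show ?case by (rule exI[of _ 1]) auto
next
  case (aff_add f g)
  obtain K where K: "K \<ge> 0"
      "\<And>x y d. (\<forall>i. \<bar>x i - y i\<bar> \<le> d) \<Longrightarrow> \<bar>f x - f y\<bar> \<le> K * d"
    using aff_add.IH(1) by blast
  obtain L where L: "L \<ge> 0"
      "\<And>x y d. (\<forall>i. \<bar>x i - y i\<bar> \<le> d) \<Longrightarrow> \<bar>g x - g y\<bar> \<le> L * d"
    using aff_add.IH(2) by blast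
  have "\<bar>f x + g x - (f y + g y)\<bar> \<le> (K + L) * d" if "\<forall>i. \<bar>x i - y i\<bar> \<le> d" for x y d
    using K(2)[OF that] L(2)[OF that] by (simp add: distrib_right)
  with K(1) L(1) show ?case by (intro exI[of _ "K + L"]) auto
next
  case (aff_scale q f)
  then obtain K where K: "K \<ge> 0"
      "\<And>x y d. (\<forall>i. \<bar>x i - y i\<bar> \<le> d) \<Longrightarrow> \<bar>f x - f y\<bar> \<le> K * d"
    by blast
  have "\<bar>q * f x - q * f y\<bar> \<le> \<bar>q\<bar> * K * d" if "\<forall>i. \<bar>x i - y i\<bar> \<le> d" for x y d
  proof -
    have "q * f x - q * f y = q * (f x - f y)" by (simp add: right_diff_distrib)
    then have "\<bar>q * f x - q * f y\<bar> = \<bar>q\<bar> * \<bar>f x - f y\<bar>" by (simp only: abs_mult)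
    also have "\<dots> \<le> \<bar>q\<bar> * (K * d)" by (intro mult_left_mono K(2) that) simp
    finally show ?thesis by (simp only: mult.assoc)
  qed
  with K(1) show ?case by (intro exI[of _ "\<bar>q\<bar> * K"]) auto
qed

text \<open>\<open>D\<close> is a common denominator of the slopes. It makes the values of
  \<open>h\<close> on an integer lattice translate discrete, which later yields a radius independent
  of the floor.\<close>

lemma aff_integral:
  assumes "aff h"
  shows "\<exists>D>0. \<forall>m. (\<forall>i. m i \<in> \<int>) \<longrightarrow> real D * (h m - h (\<lambda>_. 0)) \<in> \<int>"
  using assms
proof induction
  case (aff_add f g)
  obtain D where D: "D > 0"
      "\<And>m. (\<forall>i. m i \<in> \<int>) \<Longrightarrow> real D * (f m - f (\<lambda>_. 0)) \<in> \<int>"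
    using aff_add.IH(1) by blast
  obtain E where E: "E > 0"
      "\<And>m. (\<forall>i. m i \<in> \<int>) \<Longrightarrow> real E * (g m - g (\<lambda>_. 0)) \<in> \<int>"
    using aff_add.IH(2) by blast
  have "real (D * E) * (f m + g m - (f (\<lambda>_. 0) + g (\<lambda>_. 0))) \<in> \<int>" if "\<forall>i. m i \<in> \<int>" for m
  proof -
    have "real E * (real D * (f m - f (\<lambda>_. 0))) + real D * (real E * (g m - g (\<lambda>_. 0))) \<in> \<int>"
      by (rule Ints_add[OF Ints_mult[OF _ D(2)[OF that]] Ints_mult[OF _ E(2)[OF that]]]) auto
    then show ?thesis by (simp add: algebra_simps)
  qed
  with D(1) E(1) show ?case by (intro exI[of _ "D * E"]) auto
next
  case (aff_scale q f)
  then obtain D where D: "D > 0"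
      "\<And>m. (\<forall>i. m i \<in> \<int>) \<Longrightarrow> real D * (f m - f (\<lambda>_. 0)) \<in> \<int>"
    by blast
  obtain i n where q: "q = real_of_int i / real n" "n \<noteq> 0"
    using aff_scale(1) by (auto simp: Rats_eq_int_div_nat)
  have "real (D * n) * (q * f m - q * f (\<lambda>_. 0)) \<in> \<int>" if "\<forall>i. m i \<in> \<int>" for m
  proof -
    have "real_of_int i * (real D * (f m - f (\<lambda>_. 0))) \<in> \<int>"
      by (rule Ints_mult[OF _ D(2)[OF that]]) auto
    also have "real_of_int i = q * real n"
      using q by simp
    also have "q * real n * (real D * (f m - f (\<lambda>_. 0)))
        = real (D * n) * (q * f m - q * f (\<lambda>_. 0))"
      by (simp add: algebra_simps)
    finally show ?thesis .
  qed
  with D(1) q(2) show ?case by (intro exI[of _ "D * n"]) auto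
qed (auto intro!: exI[of _ 1])

section \<open>Sign conditions and elimination of a variable\<close>

definition same_signs :: "((nat \<Rightarrow> real) \<Rightarrow> real) set \<Rightarrow> (nat \<Rightarrow> real) \<Rightarrow> (nat \<Rightarrow> real) \<Rightarrow> bool"
  where "same_signs H x y \<longleftrightarrow> (\<forall>h\<in>H. sgn (h x) = sgn (h y))"

lemma finite_separation:
  fixes S T :: "real set"
  assumes "finite S" "finite T" "\<And>s t. s \<in> S \<Longrightarrow> t \<in> T \<Longrightarrow> s < t"
  shows "\<exists>u. (\<forall>s\<in>S. s < u) \<and> (\<forall>t\<in>T. u < t)"
proof (cases "S = {} \<or> T = {}")
  case True
  have "s < Max S + 1" if "s \<in> S" for s
    using Max_ge[OF assms(1) that] by simp
  moreover have "Min T - 1 < t" if "t \<in> T" for t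
    using Min_le[OF assms(2) that] by simp
  ultimately show ?thesis using True by blast
next
  case False
  with assms have "Max S < Min T" by simp
  then obtain u where "Max S < u" "u < Min T" using dense by blast
  with assms False show ?thesis by auto
qed

text \<open>The one-point extension step for dense orders without endpoints: \<open>u\<close> is put
  into the same gap between the values of \<open>g\<close> as \<open>t\<close> occupies between
  those of \<open>f\<close>, or onto the matching value.\<close>

lemma order_transfer:
  fixes f g :: "'a \<Rightarrow> real"
  assumes "finite A" "\<And>a b. a \<in> A \<Longrightarrow> b \<in> A \<Longrightarrow> sgn (f a - f b) = sgn (g a - g b)"
  shows "\<exists>u. \<forall>a\<in>A. sgn (t - f a) = sgn (u - g a)"
proof (cases "t \<in> f ` A")
  case True
  then obtain b where "b \<in> A" "t = f b" by blast
  then show ?thesis using assms(2)[OF \<open>b \<in> A\<close>] by blast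
next
  case False
  have "x < y" if xy: "x \<in> g ` {a\<in>A. f a < t}" "y \<in> g ` {a\<in>A. t < f a}" for x y
  proof -
    obtain a b where ab: "a \<in> A" "f a < t" "x = g a" "b \<in> A" "t < f b" "y = g b"
      using xy by auto
    have "f a - f b < 0" using ab(2,5) by linarith
    then have "sgn (g a - g b) = - 1" using assms(2)[OF ab(1,4)] by (simp only: sgn_neg)
    then show "x < y" unfolding ab(3,6) by (metis diff_less_0_iff_less sgn_1_neg)
  qed
  have "\<exists>u. (\<forall>s\<in>g ` {a\<in>A. f a < t}. s < u) \<and> (\<forall>s\<in>g ` {a\<in>A. t < f a}. u < s)"
  proof (rule finite_separation)
    show "finite (g ` {a\<in>A. f a < t})" "finite (g ` {a\<in>A. t < f a})"
      using assms(1) by simp_all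
  qed (rule \<open>\<And>x y. x \<in> g ` {a\<in>A. f a < t} \<Longrightarrow> y \<in> g ` {a\<in>A. t < f a} \<Longrightarrow> x < y\<close>)
  then obtain u where u: "\<And>a. a \<in> A \<Longrightarrow> f a < t \<Longrightarrow> g a < u" "\<And>a. a \<in> A \<Longrightarrow> t < f a \<Longrightarrow> u < g a"
    by blast
  have "sgn (t - f a) = sgn (u - g a)" if "a \<in> A" for a
  proof -
    have "t \<noteq> f a" using False that by blast
    then consider "f a < t" | "t < f a" by linarith
    then show ?thesis using u[OF that] by cases (simp_all add: sgn_real_def)
  qed
  then show ?thesis by blast
qed

text \<open>
  Fourier--Motzkin elimination: after solving for the eliminated variable, only the relative
  order of the solutions matters.
\<close>

lemma eliminate_variable:
  assumes "finite H" "\<And>h. h \<in> H \<Longrightarrow> aff h"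
  shows "\<exists>H'. finite H' \<and> (\<forall>h\<in>H'. aff h) \<and>
    (\<forall>x y. same_signs H' x y \<longrightarrow> (\<forall>t. \<exists>u. same_signs H (x(i := t)) (y(i := u))))"
proof -
  have "\<forall>h\<in>H. \<exists>q. q \<in> \<rat> \<and> (\<forall>x t. h (x(i := t)) = h (x(i := 0)) + q * t)"
    using aff_slope[OF assms(2)] by blast
  from bchoice[OF this] obtain q where q: "\<And>h. h \<in> H \<Longrightarrow> q h \<in> \<rat>"
      "\<And>h x t. h \<in> H \<Longrightarrow> h (x(i := t)) = h (x(i := 0)) + q h * t"
    by blast
  define c where "c = (\<lambda>(h :: (nat \<Rightarrow> real) \<Rightarrow> real) x. h (x(i := 0)))"
  \<comment> \<open>If \<open>q h \<noteq> 0\<close>, then \<open>r h x\<close> is the unique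
    \<open>t\<close> at which \<open>h (x(i := t))\<close> vanishes. The factor
    \<open>- 1 / q h\<close> is rational, so \<open>r h\<close> is again in
    \<open>aff\<close>.\<close>
  define r where "r = (\<lambda>h x. (- 1 / q h) * c h x)"
  define H0 where "H0 = {h \<in> H. q h = 0}"
  define H1 where "H1 = {h \<in> H. q h \<noteq> 0}"
  define H' where "H' = c ` H0 \<union> (\<lambda>(g, h) x. r g x - r h x) ` (H1 \<times> H1)"
  have "aff (c h)" if "h \<in> H" for h
    unfolding c_def using assms(2) that by (intro aff_upd_const)
  then have "aff (r h)" if "h \<in> H" for h
    unfolding r_def using that q(1) by (intro aff_scale) auto
  with \<open>\<And>h. h \<in> H \<Longrightarrow> aff (c h)\<close> have aff: "\<forall>h\<in>H'. aff h"
    by (auto simp: H'_def H0_def H1_def intro: aff_diff)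
  have fin: "finite H'"
    using assms(1) by (simp add: H'_def H0_def H1_def)
  have "\<exists>u. same_signs H (x(i := t)) (y(i := u))" if "same_signs H' x y" for x y t
  proof -
    have "sgn (r g x - r h x) = sgn (r g y - r h y)" if "g \<in> H1" "h \<in> H1" for g h
    proof -
      have "(\<lambda>x. r g x - r h x) \<in> H'" using that by (auto simp: H'_def)
      with \<open>same_signs H' x y\<close> show ?thesis by (auto simp: same_signs_def)
    qed
    then obtain u where u: "\<And>h. h \<in> H1 \<Longrightarrow> sgn (t - r h x) = sgn (u - r h y)"
      using order_transfer[of H1 "\<lambda>h. r h x" "\<lambda>h. r h y" t] assms(1) by (auto simp: H1_def)
    have "sgn (h (x(i := t))) = sgn (h (y(i := u)))" if h: "h \<in> H" for h
    proof (cases "q h = 0")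
      case True
      then have "sgn (c h x) = sgn (c h y)"
        using h \<open>same_signs H' x y\<close> by (auto simp: same_signs_def H'_def H0_def)
      with True q(2)[OF h, of x t] q(2)[OF h, of y u] show ?thesis
        unfolding c_def by (simp del: fun_upd_apply)
    next
      case False
      then have "h (z(i := s)) = q h * (s - r h z)" for z s
      proof -
        have "q h * r h z = - c h z" using False by (simp add: r_def)
        then show ?thesis
          using q(2)[OF h, of z s] by (simp only: c_def right_diff_distrib)
      qed
      moreover have "sgn (t - r h x) = sgn (u - r h y)"
        using u h False by (simp add: H1_def)
      ultimately show ?thesis by (simp only: sgn_mult)
    qed
    then show ?thesis by (auto simp: same_signs_def)
  qed
  then have "\<forall>x y. same_signs H' x y \<longrightarrow> (\<forall>t. \<exists>u. same_signs H (x(i := t)) (y(i := u)))"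
    by blast
  with fin aff show ?thesis by (intro exI[of _ H'] conjI)
qed

section \<open>Predicates read through floors and fractional parts\<close>

definition flr :: "(nat \<Rightarrow> real) \<Rightarrow> nat \<Rightarrow> real"
  where "flr e = (\<lambda>i. of_int \<lfloor>e i\<rfloor>)"

definition frc :: "(nat \<Rightarrow> real) \<Rightarrow> nat \<Rightarrow> real"
  where "frc e = (\<lambda>i. frac (e i))"

text \<open>\<open>H\<close> is chosen before the floors, while the dependence on the floors is
  arbitrary; this leaves room for arbitrary predicates on the integers. One implication suffices
  because its two hypotheses are symmetric in \<open>x\<close> and \<open>y\<close>.\<close>

definition tame :: "((nat \<Rightarrow> real) \<Rightarrow> bool) \<Rightarrow> bool"
  where "tame P \<longleftrightarrow> (\<exists>H. finite H \<and> (\<forall>h\<in>H. aff h) \<and>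
    (\<forall>x y. flr x = flr y \<longrightarrow> same_signs H (frc x) (frc y) \<longrightarrow> P x \<longrightarrow> P y))"

lemma tameI:
  assumes "finite H" "\<And>h. h \<in> H \<Longrightarrow> aff h"
    "\<And>x y. flr x = flr y \<Longrightarrow> same_signs H (frc x) (frc y) \<Longrightarrow> P x \<Longrightarrow> P y"
  shows "tame P"
  using assms unfolding tame_def by (intro exI[of _ H] conjI ballI allI impI)

lemma tameE:
  assumes "tame P"
  obtains H where "finite H" "\<And>h. h \<in> H \<Longrightarrow> aff h"
    "\<And>x y. flr x = flr y \<Longrightarrow> same_signs H (frc x) (frc y) \<Longrightarrow> P x \<Longrightarrow> P y"
  using assms unfolding tame_def by (elim exE conjE) blast

lemma same_signs_sym: "same_signs H x y \<Longrightarrow> same_signs H y x"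
  by (simp add: same_signs_def)

lemma tame_not:
  assumes "tame P"
  shows "tame (\<lambda>x. \<not> P x)"
proof (rule tameE[OF assms])
  fix H assume H: "finite H" "\<And>h. h \<in> H \<Longrightarrow> aff h"
    "\<And>x y. flr x = flr y \<Longrightarrow> same_signs H (frc x) (frc y) \<Longrightarrow> P x \<Longrightarrow> P y"
  show ?thesis
  proof (rule tameI[OF H(1,2)])
    fix x y assume xy: "flr x = flr y" "same_signs H (frc x) (frc y)" "\<not> P x"
    with H(3)[OF xy(1)[symmetric] same_signs_sym[OF xy(2)]] show "\<not> P y" by blast
  qed
qed

lemma tame_conj:
  assumes "tame P" "tame Q"
  shows "tame (\<lambda>x. P x \<and> Q x)"
proof -
  obtain H where H: "finite H" "\<And>h. h \<in> H \<Longrightarrow> aff h"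
      "\<And>x y. flr x = flr y \<Longrightarrow> same_signs H (frc x) (frc y) \<Longrightarrow> P x \<Longrightarrow> P y"
    by (rule tameE[OF assms(1)]) blast
  obtain K where K: "finite K" "\<And>h. h \<in> K \<Longrightarrow> aff h"
      "\<And>x y. flr x = flr y \<Longrightarrow> same_signs K (frc x) (frc y) \<Longrightarrow> Q x \<Longrightarrow> Q y"
    by (rule tameE[OF assms(2)]) blast
  show ?thesis
  proof (rule tameI[of "H \<union> K"])
    fix x y assume xy: "flr x = flr y" "same_signs (H \<union> K) (frc x) (frc y)" "P x \<and> Q x"
    then have "same_signs H (frc x) (frc y)" "same_signs K (frc x) (frc y)"
      by (simp_all add: same_signs_def)
    with H(3)[OF xy(1)] K(3)[OF xy(1)] xy(3) show "P y \<and> Q y" by blast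
  qed (use H K in auto)
qed

lemma tame_ex:
  assumes "tame P"
  shows "tame (\<lambda>x. \<exists>r. P (x(i := r)))"
proof -
  obtain H where H: "finite H" "\<And>h. h \<in> H \<Longrightarrow> aff h"
      "\<And>x y. flr x = flr y \<Longrightarrow> same_signs H (frc x) (frc y) \<Longrightarrow> P x \<Longrightarrow> P y"
    by (rule tameE[OF assms]) blast
  \<comment> \<open>The two extra functions force the witness found by elimination into the interval
    from 0 (included) to 1 (excluded). It is then a fractional part, and the floor of
    \<open>r\<close> can be reused for \<open>y\<close>.\<close>
  let ?K = "insert (\<lambda>x. x i) (insert (\<lambda>x. x i - 1) H)"
  have "finite ?K" "\<And>h. h \<in> ?K \<Longrightarrow> aff h"
    using H by (auto intro: aff.intros aff_diff)
  then obtain H' where H': "finite H'" "\<And>h. h \<in> H' \<Longrightarrow> aff h"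
      "\<And>x y t. same_signs H' x y \<Longrightarrow> \<exists>u. same_signs ?K (x(i := t)) (y(i := u))"
    using eliminate_variable[of ?K i] by metis
  have "\<exists>s. P (y(i := s))"
    if xy: "flr x = flr y" "same_signs H' (frc x) (frc y)" and P: "P (x(i := r))" for x y r
  proof -
    obtain u where u: "same_signs ?K ((frc x)(i := frac r)) ((frc y)(i := u))"
      using H'(3)[OF xy(2)] by metis
    have "0 \<le> frac r" "frac r < 1" by (auto simp: frac_lt_1)
    moreover have "sgn (frac r) = sgn u" "sgn (frac r - 1) = sgn (u - 1)"
      using u by (auto simp: same_signs_def)
    ultimately have u01: "0 \<le> u" "u < 1"
      by (auto simp: sgn_real_def split: if_splits)
    then have fl: "\<lfloor>of_int \<lfloor>r\<rfloor> + u\<rfloor> = \<lfloor>r\<rfloor>" by linarith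
    let ?s = "of_int \<lfloor>r\<rfloor> + u"
    have "flr (x(i := r)) = flr (y(i := ?s))"
      using fl fun_cong[OF xy(1)] by (auto simp: flr_def)
    moreover have "frc (x(i := r)) = (frc x)(i := frac r)" "frc (y(i := ?s)) = (frc y)(i := u)"
      using fl by (auto simp: frc_def frac_def)
    then have "same_signs H (frc (x(i := r))) (frc (y(i := ?s)))"
      using u by (simp add: same_signs_def)
    ultimately show ?thesis using H(3) P by blast
  qed
  with H'(1,2) show ?thesis by (intro tameI[of H']) auto
qed

text \<open>A shift of absolute value above \<open>C\<close> dominates \<open>d\<close> and decides
  the sign by itself, so only the shifts between \<open>- C\<close> and \<open>C\<close> need a
  function in \<open>H\<close>. This is what makes one finite set serve infinitely many
  floors.\<close>

lemma integer_shift_signs: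
  fixes C :: nat
  assumes "aff d" "\<And>x. \<bar>d (frc x)\<bar> \<le> real C"
  shows "\<exists>H. finite H \<and> (\<forall>h\<in>H. aff h) \<and>
    (\<forall>x y k. same_signs H (frc x) (frc y) \<longrightarrow> k \<in> \<int> \<longrightarrow> sgn (d (frc x) + k) = sgn (d (frc y) + k))"
proof -
  let ?H = "(\<lambda>k x. d x + real_of_int k) ` {- int C..int C}"
  have "sgn (d (frc x) + k) = sgn (d (frc y) + k)"
    if xy: "same_signs ?H (frc x) (frc y)" and "k \<in> \<int>" for x y k
  proof -
    obtain l where l: "k = real_of_int l" using \<open>k \<in> \<int>\<close> by (auto elim: Ints_cases)
    consider "l \<in> {- int C..int C}" | "l \<ge> int C + 1" | "l \<le> - int C - 1" by fastforce
    then show ?thesis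
    proof cases
      case 1
      then show ?thesis using xy l by (auto simp: same_signs_def)
    next
      case 2
      then have "k \<ge> real C + 1" unfolding l by linarith
      then have "d (frc x) + k > 0" "d (frc y) + k > 0"
        using assms(2)[of x] assms(2)[of y] by linarith+
      then show ?thesis by simp
    next
      case 3
      then have "k \<le> - real C - 1" unfolding l by linarith
      then have "d (frc x) + k < 0" "d (frc y) + k < 0"
        using assms(2)[of x] assms(2)[of y] by linarith+
      then show ?thesis by simp
    qed
  qed
  moreover have "\<forall>h\<in>?H. aff h" using assms(1) by (auto intro: aff.intros)
  ultimately show ?thesis by (intro exI[of _ ?H]) blast
qed

section \<open>Formulas over expansions by sets of natural numbers\<close>

locale integer_expansion =
  fixes M :: real_struct
  assumes ops_eq: "ops M = {(2, add_op)}"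
    and rels_cases: "(k, S) \<in> rels M \<Longrightarrow> (k = 2 \<and> S = less_rel) \<or> S \<subseteq> Nn k"
begin

text \<open>A term built from \<open>add_op\<close> is a sum of variables, hence additive in the
  assignment: it splits into a part from the floors, which is an integer, and a part from the
  fractional parts, which is at most the number of variable occurrences.\<close>

lemma val_properties:
  assumes "trm_over M t"
  shows "aff (\<lambda>e. val e t) \<and> (\<forall>e. val e t = val (frc e) t + val (flr e) t \<and> val (flr e) t \<in> \<int>) \<and>
    (\<exists>C::nat. \<forall>e. 0 \<le> val (frc e) t \<and> val (frc e) t \<le> real C)"
  using assms
proof (induction t)
  case (Var i)
  have "\<exists>C::nat. \<forall>e. 0 \<le> frac (e i) \<and> frac (e i) \<le> real C"
    by (intro exI[of _ 1]) (simp add: less_imp_le[OF frac_lt_1])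
  then show ?case by (simp add: aff_var flr_def frc_def frac_def)
next
  case (App f ts)
  then have f: "f = add_op" and "length ts = 2" by (auto simp: ops_eq)
  then obtain s t where ts: "ts = [s, t]"
    by (auto simp: numeral_2_eq_2 length_Suc_conv)
  with App.prems have over: "trm_over M s" "trm_over M t" by auto
  have st: "s \<in> set ts" "t \<in> set ts" using ts by auto
  have s: "aff (\<lambda>e. val e s)" "\<And>e. val e s = val (frc e) s + val (flr e) s"
      "\<And>e. val (flr e) s \<in> \<int>" "\<exists>C::nat. \<forall>e. 0 \<le> val (frc e) s \<and> val (frc e) s \<le> real C"
    using App.IH[OF st(1) over(1)] by blast+
  have t: "aff (\<lambda>e. val e t)" "\<And>e. val e t = val (frc e) t + val (flr e) t"
      "\<And>e. val (flr e) t \<in> \<int>" "\<exists>C::nat. \<forall>e. 0 \<le> val (frc e) t \<and> val (frc e) t \<le> real C"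
    using App.IH[OF st(2) over(2)] by blast+
  have val: "val e (App f ts) = val e s + val e t" for e
    by (simp add: f ts add_op_def)
  obtain C :: nat where C: "\<And>e. 0 \<le> val (frc e) s \<and> val (frc e) s \<le> real C"
    using s(4) by blast
  obtain D :: nat where D: "\<And>e. 0 \<le> val (frc e) t \<and> val (frc e) t \<le> real D"
    using t(4) by blast
  show ?case
    unfolding val
  proof (intro conjI allI)
    show "aff (\<lambda>e. val e s + val e t)"
      using s(1) t(1) by (rule aff_add)
    show "\<exists>C::nat. \<forall>e. 0 \<le> val (frc e) s + val (frc e) t \<and> val (frc e) s + val (frc e) t \<le> real C"
      using C D by (intro exI[of _ "C + D"]) (simp add: add_nonneg_nonneg add_mono)
    fix e
    show "val e s + val e t = val (frc e) s + val (frc e) t + (val (flr e) s + val (flr e) t)"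
      using s(2)[of e] t(2)[of e] by linarith
    show "val (flr e) s + val (flr e) t \<in> \<int>"
      using s(3) t(3) by (rule Ints_add)
  qed
qed

lemma val_decomp:
  assumes "trm_over M t"
  shows "aff (\<lambda>e. val e t)" "val e t = val (frc e) t + val (flr e) t" "val (flr e) t \<in> \<int>"
    "\<exists>C::nat. \<forall>e. \<bar>val (frc e) t\<bar> \<le> real C"
proof -
  note t = val_properties[OF assms]
  show "aff (\<lambda>e. val e t)" "val e t = val (frc e) t + val (flr e) t" "val (flr e) t \<in> \<int>"
    using t by blast+
  from t obtain C :: nat where "\<And>e. 0 \<le> val (frc e) t \<and> val (frc e) t \<le> real C"
    by blast
  then show "\<exists>C::nat. \<forall>e. \<bar>val (frc e) t\<bar> \<le> real C"
    by (intro exI[of _ C]) simp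
qed

lemma val_diff_signs:
  assumes "trm_over M s" "trm_over M t"
  shows "\<exists>H. finite H \<and> (\<forall>h\<in>H. aff h) \<and>
    (\<forall>x y. flr x = flr y \<longrightarrow> same_signs H (frc x) (frc y) \<longrightarrow>
      sgn (val x s - val x t) = sgn (val y s - val y t))"
proof -
  note s = val_decomp[OF assms(1)] and t = val_decomp[OF assms(2)]
  obtain C :: nat where C: "\<And>e. \<bar>val (frc e) s\<bar> \<le> real C"
    using s(4) by blast
  obtain D :: nat where D: "\<And>e. \<bar>val (frc e) t\<bar> \<le> real D"
    using t(4) by blast
  have bound: "\<bar>val (frc e) s - val (frc e) t\<bar> \<le> real (C + D)" for e
    using C[of e] D[of e] by linarith
  obtain H where H: "finite H" "\<forall>h\<in>H. aff h"
    "\<And>x y k. same_signs H (frc x) (frc y) \<Longrightarrow> k \<in> \<int> \<Longrightarrow>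
      sgn (val (frc x) s - val (frc x) t + k) = sgn (val (frc y) s - val (frc y) t + k)"
    using integer_shift_signs[of "\<lambda>e. val e s - val e t" "C + D", OF aff_diff[OF s(1) t(1)] bound]
    by blast
  have "sgn (val x s - val x t) = sgn (val y s - val y t)"
    if xy: "flr x = flr y" "same_signs H (frc x) (frc y)" for x y
  proof -
    have eq: "val z s - val z t = val (frc z) s - val (frc z) t + (val (flr z) s - val (flr z) t)" for z
      using s(2)[of z] t(2)[of z] by linarith
    have "val (flr x) s - val (flr x) t \<in> \<int>" using s(3) t(3) by (rule Ints_diff)
    from H(3)[OF xy(2) this] show ?thesis
      unfolding eq[of x] eq[of y] xy(1)[symmetric] .
  qed
  with H(1,2) show ?thesis by blast
qed

text \<open>A relation inside \<open>Nn k\<close> can hold only at integer values of its argument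
  terms, so it suffices that such values persist; the relation itself may be arbitrary. The shift
  \<open>val (flr x) t - val x t\<close> produces sign 0 at \<open>x\<close>, and sign 0 at
  \<open>y\<close> says that the value is unchanged.\<close>

lemma val_integer_values:
  assumes "trm_over M t"
  shows "\<exists>H. finite H \<and> (\<forall>h\<in>H. aff h) \<and>
    (\<forall>x y. flr x = flr y \<longrightarrow> same_signs H (frc x) (frc y) \<longrightarrow> val x t \<in> \<int> \<longrightarrow> val y t = val x t)"
proof -
  note t = val_decomp[OF assms]
  obtain C :: nat where C: "\<And>e. \<bar>val (frc e) t\<bar> \<le> real C"
    using t(4) by blast
  obtain H where H: "finite H" "\<forall>h\<in>H. aff h"
    "\<And>x y k. same_signs H (frc x) (frc y) \<Longrightarrow> k \<in> \<int> \<Longrightarrow>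
      sgn (val (frc x) t + k) = sgn (val (frc y) t + k)"
    using integer_shift_signs[of "\<lambda>e. val e t" C, OF t(1) C] by blast
  have "val y t = val x t"
    if xy: "flr x = flr y" "same_signs H (frc x) (frc y)" "val x t \<in> \<int>" for x y
  proof -
    have "val (flr x) t - val x t \<in> \<int>" using t(3) xy(3) by (rule Ints_diff)
    from H(3)[OF xy(2) this]
    have "sgn (val (frc x) t + val (flr x) t - val x t) = sgn (val (frc y) t + val (flr y) t - val x t)"
      by (simp add: xy(1) add_diff_eq)
    then have "sgn (val x t - val x t) = sgn (val y t - val x t)"
      by (simp only: t(2)[of x, symmetric] t(2)[of y, symmetric])
    then show ?thesis by (simp add: sgn_0_0)
  qed
  with H(1,2) show ?thesis by blast
qed

lemma tame_sat: "fm_over M \<phi> \<Longrightarrow> tame (\<lambda>e. sat e \<phi>)"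
proof (induction \<phi>)
  case (Eq s t)
  then obtain H where "finite H" "\<forall>h\<in>H. aff h"
      "\<And>x y. flr x = flr y \<Longrightarrow> same_signs H (frc x) (frc y) \<Longrightarrow>
        sgn (val x s - val x t) = sgn (val y s - val y t)"
    using val_diff_signs[of s t] by auto
  then show ?case
    by (intro tameI[of H]) (simp, blast, metis sat.simps(1) eq_iff_diff_eq_0 sgn_0_0)
next
  case (Rel R ts)
  then consider "length ts = 2" "R = less_rel" | "R \<subseteq> Nn (length ts)"
    using rels_cases by auto
  then show ?case
  proof cases
    case 1
    then obtain s t where ts: "ts = [s, t]" by (auto simp: numeral_2_eq_2 length_Suc_conv)
    with Rel obtain H where H: "finite H" "\<forall>h\<in>H. aff h"
      "\<And>x y. flr x = flr y \<Longrightarrow> same_signs H (frc x) (frc y) \<Longrightarrow>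
        sgn (val x s - val x t) = sgn (val y s - val y t)"
      using val_diff_signs[of s t] by auto
    have "sat x (Rel R ts) \<longleftrightarrow> sgn (val x s - val x t) = - 1" for x
      using 1(2) by (auto simp: ts less_rel_def Rn_iff nth_default_beyond sgn_real_def)
    with H show ?thesis by (intro tameI[of H]) (simp, blast, metis)
  next
    case 2
    have "\<forall>t\<in>set ts. \<exists>H. finite H \<and> (\<forall>h\<in>H. aff h) \<and>
        (\<forall>x y. flr x = flr y \<longrightarrow> same_signs H (frc x) (frc y) \<longrightarrow> val x t \<in> \<int> \<longrightarrow> val y t = val x t)"
      using Rel by (intro ballI val_integer_values) (auto simp: list_all_iff)
    then obtain H where H: "\<And>t. t \<in> set ts \<Longrightarrow> finite (H t) \<and> (\<forall>h\<in>H t. aff h)"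
        "\<And>t x y. t \<in> set ts \<Longrightarrow> flr x = flr y \<Longrightarrow> same_signs (H t) (frc x) (frc y) \<Longrightarrow>
          val x t \<in> \<int> \<Longrightarrow> val y t = val x t"
      by metis
    let ?H = "\<Union>t\<in>set ts. H t"
    have "sat y (Rel R ts)"
      if xy: "flr x = flr y" "same_signs ?H (frc x) (frc y)" and sat: "sat x (Rel R ts)" for x y
    proof -
      have "val y t = val x t" if t: "t \<in> set ts" for t
      proof (rule H(2)[OF t xy(1)])
        show "same_signs (H t) (frc x) (frc y)" using xy(2) t by (auto simp: same_signs_def)
        obtain i where i: "i < length ts" "ts ! i = t" using t by (auto simp: in_set_conv_nth)
        have "nth_default 0 (map (val x) ts) i \<in> \<nat>"
          using sat 2 i(1) by (auto simp: Nn_def)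
        then show "val x t \<in> \<int>" using i Nats_subset_Ints by (auto simp: nth_default_nth)
      qed
      then have "map (val y) ts = map (val x) ts" by simp
      with sat show ?thesis by (simp only: sat.simps)
    qed
    with H(1) show ?thesis by (intro tameI[of ?H]) (simp, blast, blast)
  qed
next
  case (Neg \<phi>)
  then show ?case by (simp add: tame_not)
next
  case (Conj \<phi> \<psi>)
  then show ?case by (simp add: tame_conj)
next
  case (Ex i \<phi>)
  then show ?case using tame_ex[of "\<lambda>e. sat e \<phi>" i] by simp
qed

lemma definable_determined_by_signs:
  assumes "definable M n E"
  shows "\<exists>H. finite H \<and> (\<forall>h\<in>H. aff h) \<and>
    (\<forall>x\<in>Rn n. \<forall>y\<in>Rn n. flr x = flr y \<longrightarrow> same_signs H (frc x) (frc y) \<longrightarrow> x \<in> E \<longrightarrow> y \<in> E)"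
proof -
  obtain \<phi> a where \<phi>: "fm_over M \<phi>" "E = {x \<in> Rn n. sat (\<lambda>i. if i < n then x i else a i) \<phi>}"
    using assms by (auto simp: definable_def)
  obtain H where H: "finite H" "\<And>h. h \<in> H \<Longrightarrow> aff h"
      "\<And>x y. flr x = flr y \<Longrightarrow> same_signs H (frc x) (frc y) \<Longrightarrow> sat x \<phi> \<Longrightarrow> sat y \<phi>"
    by (rule tameE[OF tame_sat[OF \<phi>(1)]]) blast
  \<comment> \<open>The floors of the parameters never vary; their fractional parts are substituted
    into the functions of \<open>H\<close> and become real constant terms.\<close>
  define p where "p = (\<lambda>x i. if i < n then x i else frac (a i))"
  define ext where "ext = (\<lambda>x i. if i < n then x i else a i)"
  have frc: "frc (ext x) = p (frc x)" for x
    by (auto simp: frc_def p_def ext_def)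
  have flr: "flr (ext x) = flr (ext y)" if "flr x = flr y" for x y
    using fun_cong[OF that] by (auto simp: flr_def ext_def)
  have "aff (\<lambda>x. h (p x))" if "h \<in> H" for h
  proof (rule aff_subst[OF H(2)[OF that]])
    show "aff (\<lambda>x. p x i)" for i
      by (cases "i < n") (simp_all add: p_def aff_var aff_const)
  qed
  moreover have "y \<in> E"
    if "y \<in> Rn n" "flr x = flr y" "same_signs ((\<lambda>h x. h (p x)) ` H) (frc x) (frc y)" "x \<in> E" for x y
  proof -
    have "E = {x \<in> Rn n. sat (ext x) \<phi>}" using \<phi>(2) by (simp add: ext_def)
    moreover have "same_signs H (frc (ext x)) (frc (ext y))"
      using that(3) by (simp add: frc same_signs_def)
    ultimately show ?thesis using H(3)[OF flr[OF that(2)]] that(1,4) by blast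
  qed
  ultimately show ?thesis
    using H(1) by (intro exI[of _ "(\<lambda>h x. h (p x)) ` H"]) blast
qed

end

section \<open>Definable paths\<close>

interpretation R_less_add: ordered_group_struct R_less_add
  by standard (simp_all add: R_less_add_def)

lemma path_joining_iff:
  assumes "E \<subseteq> Rn n"
  shows "path_joining n E a b \<gamma> x y \<longleftrightarrow>
    a \<le> b \<and> (\<forall>k. continuous_on {a..b} (\<lambda>t. \<gamma> t k)) \<and> \<gamma> a = x \<and> \<gamma> b = y \<and> \<gamma> ` {a..b} \<subseteq> E"
proof -
  have "continuous_map (top_of_set {a..b}) (Euclidean_space n) \<gamma> \<longleftrightarrow>
      (\<forall>k. continuous_on {a..b} (\<lambda>t. \<gamma> t k))" if "\<gamma> ` {a..b} \<subseteq> Rn n"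
    using that unfolding Euclidean_space_def
    by (auto simp: continuous_map_in_subtopology continuous_map_componentwise_UNIV)
  with assms show ?thesis by (auto simp: path_joining_def)
qed

lemma definable_path_iff:
  assumes "\<And>t. t \<in> {a..b} \<Longrightarrow> \<gamma> t \<in> Rn n"
  shows "definable_path M n a b \<gamma> \<longleftrightarrow>
    dpred M (\<lambda>e. a \<le> e 0 \<and> e 0 \<le> b \<and> (\<forall>i<n. e (Suc i) = \<gamma> (e 0) i))"
proof -
  let ?G = "{case_nat t (\<gamma> t) | t. t \<in> {a..b}}"
  have "?G \<subseteq> Rn (Suc n)"
    using assms by (auto simp: Rn_iff split: nat.splits)
  moreover have "trunc (Suc n) e \<in> ?G \<longleftrightarrow> a \<le> e 0 \<and> e 0 \<le> b \<and> (\<forall>i<n. e (Suc i) = \<gamma> (e 0) i)" for e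
  proof
    assume "trunc (Suc n) e \<in> ?G"
    then obtain t where t: "t \<in> {a..b}" "trunc (Suc n) e = case_nat t (\<gamma> t)" by blast
    have "e 0 = t" using fun_cong[OF t(2), of 0] by (simp add: trunc_def)
    moreover have "e (Suc i) = \<gamma> t i" if "i < n" for i
      using fun_cong[OF t(2), of "Suc i"] that by (simp add: trunc_def)
    ultimately show "a \<le> e 0 \<and> e 0 \<le> b \<and> (\<forall>i<n. e (Suc i) = \<gamma> (e 0) i)"
      using t(1) by simp
  next
    assume e: "a \<le> e 0 \<and> e 0 \<le> b \<and> (\<forall>i<n. e (Suc i) = \<gamma> (e 0) i)"
    have "trunc (Suc n) e j = case_nat (e 0) (\<gamma> (e 0)) j" for j
    proof (cases j)
      case (Suc i)
      then show ?thesis using e assms[of "e 0"] by (cases "i < n") (auto simp: trunc_def Rn_iff)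
    qed (simp add: trunc_def)
    then have "trunc (Suc n) e = case_nat (e 0) (\<gamma> (e 0))" ..
    with e show "trunc (Suc n) e \<in> ?G" by auto
  qed
  ultimately show ?thesis
    by (simp add: definable_path_def definable_iff_dpred)
qed

lemma dpred_reparametrize:
  assumes "dpred M (\<lambda>e. a \<le> e 0 \<and> e 0 \<le> b \<and> (\<forall>i<n. e (Suc i) = \<gamma> (e 0) i))" "dfun M t"
  shows "dpred M (\<lambda>e. a \<le> t e \<and> t e \<le> b \<and> (\<forall>i<n. e (Suc i) = \<gamma> (t e) i))"
proof (rule dpred_subst[OF _ assms(2)])
  have "inj (case_nat 0 (\<lambda>i. Suc (Suc i)))"
    by (intro injI) (auto split: nat.splits)
  from dpred_inj[OF assms(1) this]
  show "dpred M (\<lambda>e. a \<le> e 0 \<and> e 0 \<le> b \<and> (\<forall>i<n. e (Suc (Suc i)) = \<gamma> (e 0) i))"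
    by simp
qed

definition joined :: "nat \<Rightarrow> (nat \<Rightarrow> real) set \<Rightarrow> (nat \<Rightarrow> real) \<Rightarrow> (nat \<Rightarrow> real) \<Rightarrow> bool"
  where "joined n E x y \<longleftrightarrow>
    (\<exists>a b \<gamma>. path_joining n E a b \<gamma> x y \<and> definable_path R_less_add n a b \<gamma>)"

lemma joinedI:
  assumes "E \<subseteq> Rn n" "a \<le> b" "\<And>k. continuous_on {a..b} (\<lambda>t. \<gamma> t k)" "\<gamma> a = x" "\<gamma> b = y"
    "\<And>t. t \<in> {a..b} \<Longrightarrow> \<gamma> t \<in> E"
    "dpred R_less_add (\<lambda>e. a \<le> e 0 \<and> e 0 \<le> b \<and> (\<forall>i<n. e (Suc i) = \<gamma> (e 0) i))"
  shows "joined n E x y"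
proof -
  have "\<gamma> t \<in> Rn n" if "t \<in> {a..b}" for t
    using assms(1,6) that by blast
  then have "definable_path R_less_add n a b \<gamma>"
    using assms(7) definable_path_iff by blast
  moreover have "path_joining n E a b \<gamma> x y"
    using assms by (auto simp: path_joining_iff)
  ultimately show ?thesis by (auto simp: joined_def)
qed

lemma joinedE:
  assumes "joined n E x y" "E \<subseteq> Rn n"
  obtains a b \<gamma> where "a \<le> b" "\<And>k. continuous_on {a..b} (\<lambda>t. \<gamma> t k)" "\<gamma> a = x" "\<gamma> b = y"
    "\<And>t. t \<in> {a..b} \<Longrightarrow> \<gamma> t \<in> E"
    "dpred R_less_add (\<lambda>e. a \<le> e 0 \<and> e 0 \<le> b \<and> (\<forall>i<n. e (Suc i) = \<gamma> (e 0) i))"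
proof -
  obtain a b \<gamma> where p: "path_joining n E a b \<gamma> x y" "definable_path R_less_add n a b \<gamma>"
    using assms(1) by (auto simp: joined_def)
  then have "\<gamma> t \<in> Rn n" if "t \<in> {a..b}" for t
    using p(1) assms(2) that by (auto simp: path_joining_def image_subset_iff)
  then have "dpred R_less_add (\<lambda>e. a \<le> e 0 \<and> e 0 \<le> b \<and> (\<forall>i<n. e (Suc i) = \<gamma> (e 0) i))"
    using p(2) definable_path_iff by blast
  with p(1) that show ?thesis
    unfolding path_joining_iff[OF assms(2)] by blast
qed

lemma joined_segment:
  assumes "E \<subseteq> Rn n" "\<And>i. w i \<in> \<rat>" "s \<ge> 0"
    and "\<And>t. 0 \<le> t \<Longrightarrow> t \<le> s \<Longrightarrow> (\<lambda>i. x i + t * w i) \<in> E"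
  shows "joined n E x (\<lambda>i. x i + s * w i)"
proof (rule joinedI[where \<gamma> = "\<lambda>t i. x i + t * w i" and a = 0 and b = s])
  have "dfun R_less_add (\<lambda>e. x i + e 0 * w i)" for i
    using R_less_add.dfun_add[OF dfun_const R_less_add.dfun_rat_scale[OF assms(2) dfun_var]]
    by (simp add: mult.commute)
  then show "dpred R_less_add (\<lambda>e. 0 \<le> e 0 \<and> e 0 \<le> s \<and> (\<forall>i<n. e (Suc i) = x i + e 0 * w i))"
    by (intro dpred_conj R_less_add.dpred_le dfun_var dfun_const dpred_all_less dpred_eq)
qed (use assms in \<open>auto intro!: continuous_intros\<close>)

lemma joined_refl:
  assumes "E \<subseteq> Rn n" "x \<in> E"
  shows "joined n E x x"
  using joined_segment[OF assms(1), of "\<lambda>_. 0" 0 x] assms(2) by simp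

lemma joined_sym:
  assumes "E \<subseteq> Rn n" "joined n E x y"
  shows "joined n E y x"
proof -
  obtain a b \<gamma> where \<gamma>: "a \<le> b" "\<And>k. continuous_on {a..b} (\<lambda>t. \<gamma> t k)" "\<gamma> a = x" "\<gamma> b = y"
    "\<And>t. t \<in> {a..b} \<Longrightarrow> \<gamma> t \<in> E"
    "dpred R_less_add (\<lambda>e. a \<le> e 0 \<and> e 0 \<le> b \<and> (\<forall>i<n. e (Suc i) = \<gamma> (e 0) i))"
    by (rule joinedE[OF assms(2,1)]) blast
  show ?thesis
  proof (rule joinedI[where \<gamma> = "\<lambda>t. \<gamma> (- t)" and a = "- b" and b = "- a"])
    have "dpred R_less_add (\<lambda>e. a \<le> - e 0 \<and> - e 0 \<le> b \<and> (\<forall>i<n. e (Suc i) = \<gamma> (- e 0) i))"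
      by (rule dpred_reparametrize[OF \<gamma>(6) R_less_add.dfun_uminus[OF dfun_var]])
    moreover have "- b \<le> e 0 \<and> e 0 \<le> - a \<and> Q \<longleftrightarrow> a \<le> - e 0 \<and> - e 0 \<le> b \<and> Q"
      for e :: "nat \<Rightarrow> real" and Q by auto
    ultimately show "dpred R_less_add
        (\<lambda>e. - b \<le> e 0 \<and> e 0 \<le> - a \<and> (\<forall>i<n. e (Suc i) = \<gamma> (- e 0) i))"
      by (simp only:)
    show "continuous_on {- b..- a} (\<lambda>t. \<gamma> (- t) k)" for k
      by (rule continuous_on_compose2[OF \<gamma>(2)]) (auto intro!: continuous_intros)
  qed (use \<gamma> assms in auto)
qed

lemma joined_trans:
  assumes "E \<subseteq> Rn n" "joined n E x y" "joined n E y z"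
  shows "joined n E x z"
proof -
  obtain a b \<gamma> where \<gamma>: "a \<le> b" "\<And>k. continuous_on {a..b} (\<lambda>t. \<gamma> t k)" "\<gamma> a = x" "\<gamma> b = y"
    "\<And>t. t \<in> {a..b} \<Longrightarrow> \<gamma> t \<in> E"
    "dpred R_less_add (\<lambda>e. a \<le> e 0 \<and> e 0 \<le> b \<and> (\<forall>i<n. e (Suc i) = \<gamma> (e 0) i))"
    by (rule joinedE[OF assms(2,1)]) blast
  obtain c d \<delta> where \<delta>: "c \<le> d" "\<And>k. continuous_on {c..d} (\<lambda>t. \<delta> t k)" "\<delta> c = y" "\<delta> d = z"
    "\<And>t. t \<in> {c..d} \<Longrightarrow> \<delta> t \<in> E"
    "dpred R_less_add (\<lambda>e. c \<le> e 0 \<and> e 0 \<le> d \<and> (\<forall>i<n. e (Suc i) = \<delta> (e 0) i))"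
    by (rule joinedE[OF assms(3,1)]) blast
  \<comment> \<open>The second path is only translated in time so as to start at \<open>b\<close>;
    translation by the constant \<open>c - b\<close> is definable. The graph is then the union of
    two definable graphs that agree at time \<open>b\<close>.\<close>
  define \<eta> where "\<eta> = (\<lambda>t. if t \<le> b then \<gamma> t else \<delta> (t + (c - b)))"
  have \<eta>: "\<eta> t = \<gamma> t" if "t \<le> b" for t
    using that by (simp add: \<eta>_def)
  have \<eta>': "\<eta> t = \<delta> (t + (c - b))" if "b \<le> t" for t
    using that \<gamma>(4) \<delta>(3) by (cases "t = b") (auto simp: \<eta>_def)
  show ?thesis
  proof (rule joinedI[where \<gamma> = \<eta> and a = a and b = "d - (c - b)"])
    show "continuous_on {a..d - (c - b)} (\<lambda>t. \<eta> t k)" for k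
    proof -
      have "continuous_on {a..b} (\<lambda>t. \<eta> t k)"
        using \<gamma>(2)[of k] by (rule continuous_on_eq) (simp add: \<eta>)
      moreover have "continuous_on {b..d - (c - b)} (\<lambda>t. \<delta> (t + (c - b)) k)"
        by (rule continuous_on_compose2[OF \<delta>(2)]) (auto intro!: continuous_intros)
      then have "continuous_on {b..d - (c - b)} (\<lambda>t. \<eta> t k)"
        by (rule continuous_on_eq) (simp add: \<eta>')
      ultimately have "continuous_on ({a..b} \<union> {b..d - (c - b)}) (\<lambda>t. \<eta> t k)"
        by (intro continuous_on_closed_Un) auto
      moreover have "{a..b} \<union> {b..d - (c - b)} = {a..d - (c - b)}"
        using \<gamma>(1) \<delta>(1) by auto
      ultimately show ?thesis by simp
    qed
    have "dpred R_less_add (\<lambda>e. (a \<le> e 0 \<and> e 0 \<le> b \<and> (\<forall>i<n. e (Suc i) = \<gamma> (e 0) i)) \<or>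
        (c \<le> e 0 + (c - b) \<and> e 0 + (c - b) \<le> d \<and> (\<forall>i<n. e (Suc i) = \<delta> (e 0 + (c - b)) i)))"
      by (intro dpred_disj \<gamma>(6) dpred_reparametrize[OF \<delta>(6)]
          R_less_add.dfun_add[OF dfun_var dfun_const])
    moreover have "((a \<le> e 0 \<and> e 0 \<le> b \<and> (\<forall>i<n. e (Suc i) = \<gamma> (e 0) i)) \<or>
        (c \<le> e 0 + (c - b) \<and> e 0 + (c - b) \<le> d \<and> (\<forall>i<n. e (Suc i) = \<delta> (e 0 + (c - b)) i)))
      \<longleftrightarrow> a \<le> e 0 \<and> e 0 \<le> d - (c - b) \<and> (\<forall>i<n. e (Suc i) = \<eta> (e 0) i)" for e
    proof (cases "e 0 \<le> b")
      case True
      have "\<eta> (e 0) = \<delta> (e 0 + (c - b))" if "b \<le> e 0" using \<eta>'[OF that] .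
      with True \<eta>[OF True] \<gamma>(1) \<delta>(1) show ?thesis by auto
    next
      case False
      with \<eta>'[of "e 0"] \<gamma>(1) show ?thesis by auto
    qed
    ultimately show "dpred R_less_add
        (\<lambda>e. a \<le> e 0 \<and> e 0 \<le> d - (c - b) \<and> (\<forall>i<n. e (Suc i) = \<eta> (e 0) i))"
      by (simp only:)
    show "\<eta> t \<in> E" if "t \<in> {a..d - (c - b)}" for t
      using that \<gamma>(5)[of t] \<delta>(5)[of "t + (c - b)"] by (cases "t \<le> b") (auto simp: \<eta> \<eta>')
  qed (use \<gamma> \<delta> assms \<eta> \<eta>' in auto)
qed

lemma joined_connectedin:
  assumes "E \<subseteq> Rn n" "joined n E x y"
  shows "\<exists>P. connectedin (subtopology (Euclidean_space n) E) P \<and> x \<in> P \<and> y \<in> P"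
proof -
  obtain a b \<gamma> where \<gamma>: "path_joining n E a b \<gamma> x y"
    using assms(2) by (auto simp: joined_def)
  have "connectedin (top_of_set {a..b}) {a..b}" by (simp add: connectedin_absolute)
  then have "connectedin (Euclidean_space n) (\<gamma> ` {a..b})"
    using \<gamma> by (intro connectedin_continuous_map_image) (auto simp: path_joining_def)
  with \<gamma> show ?thesis
    by (intro exI[of _ "\<gamma> ` {a..b}"]) (auto simp: path_joining_def connectedin_subtopology)
qed

section \<open>Polygonal paths with rational directions\<close>

lemma aff_linear_combination:
  assumes "aff h" "finite S"
  shows "h (\<lambda>i. x i + (\<Sum>j\<in>S. c j * w j i)) = h x + (\<Sum>j\<in>S. c j * (h (w j) - h (\<lambda>_. 0)))"
  using assms(2)
proof induction
  case (insert k S)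
  have "h (\<lambda>i. (x i + (\<Sum>j\<in>S. c j * w j i)) + c k * w k i)
      = h (\<lambda>i. x i + (\<Sum>j\<in>S. c j * w j i)) + c k * (h (w k) - h (\<lambda>_. 0))"
    by (rule aff_line[OF assms(1)])
  with insert show ?case by (simp add: add_ac)
qed simp

text \<open>
  The coefficients of a representation of \<open>v\<close> with the least number of rational vectors are
  linearly independent over the rationals, so that every rational linear functional that
  vanishes at \<open>v\<close> vanishes at each of these vectors.
\<close>

lemma rational_decomposition:
  assumes "v \<in> Rn n"
  obtains S :: "nat set" and c w where "finite S" "\<And>j i. w j i \<in> \<rat>" "\<And>j. w j \<in> Rn n"
    "v = (\<lambda>i. \<Sum>j\<in>S. c j * w j i)"
    "\<And>h j. aff h \<Longrightarrow> h v = h (\<lambda>_. 0) \<Longrightarrow> j \<in> S \<Longrightarrow> h (w j) = h (\<lambda>_. 0)"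
proof -
  define rep where "rep = (\<lambda>(S :: nat set) c (w :: nat \<Rightarrow> nat \<Rightarrow> real). finite S \<and> (\<forall>j i. w j i \<in> \<rat>) \<and>
      (\<forall>j. w j \<in> Rn n) \<and> v = (\<lambda>i. \<Sum>j\<in>S. c j * w j i))"
  define P where "P = (\<lambda>r. \<exists>S c w. card S = r \<and> rep S c w)"
  have "(\<Sum>j<n. v j * (if j = i \<and> j < n then 1 else 0)) = v i" for i
  proof -
    have "(\<Sum>j<n. v j * (if j = i \<and> j < n then 1 else 0)) = (\<Sum>j<n. if j = i then v j else 0)"
      by (intro sum.cong) auto
    then show ?thesis using assms by (simp add: Rn_iff)
  qed
  then have "v = (\<lambda>i. \<Sum>j<n. v j * (if j = i \<and> j < n then 1 else 0))"
    by (simp only:)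
  then have "rep {..<n} v (\<lambda>j i. if j = i \<and> j < n then 1 else 0)"
    unfolding rep_def by (intro conjI) (auto simp: Rn_iff)
  then have "P n" unfolding P_def by (intro exI[of _ "{..<n}"]) auto
  then have "P (Least P)" by (rule LeastI)
  then obtain S c w where S: "card S = Least P" "rep S c w" by (auto simp: P_def)
  have "h (w k) = h (\<lambda>_. 0)" if h: "aff h" "h v = h (\<lambda>_. 0)" and k: "k \<in> S" for h k
  proof (rule ccontr)
    assume ne: "h (w k) \<noteq> h (\<lambda>_. 0)"
    define q where "q = (\<lambda>j. h (w j) - h (\<lambda>_. 0))"
    have qR: "q j \<in> \<rat>" for j
      unfolding q_def using S(2) by (intro aff_diff_Rats h) (auto simp: rep_def)
    have qk: "q k \<noteq> 0" using ne by (simp add: q_def)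
    have fin: "finite S" using S(2) by (simp add: rep_def)
    have "h v = h (\<lambda>_. 0) + (\<Sum>j\<in>S. c j * q j)"
      using aff_linear_combination[OF h(1) fin, of "\<lambda>_. 0" c w] S(2) by (simp add: rep_def q_def)
    then have "c k * q k + (\<Sum>j\<in>S - {k}. c j * q j) = 0"
      using h(2) sum.remove[OF fin k, of "\<lambda>j. c j * q j"] by simp
    then have ck: "c k = - (\<Sum>j\<in>S - {k}. c j * q j) / q k"
      using qk by (simp add: field_simps eq_neg_iff_add_eq_0)
    \<comment> \<open>The vanishing of \<open>h\<close> at \<open>v\<close> gives a rational linear
      relation that expresses \<open>c k\<close> through the other coefficients. Absorbing it into
      the remaining vectors keeps them rational and disposes of \<open>k\<close>, against
      minimality.\<close>
    define w' where "w' = (\<lambda>j i. w j i - q j / q k * w k i)"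
    have "v i = (\<Sum>j\<in>S - {k}. c j * w' j i)" for i
    proof -
      have "v i = c k * w k i + (\<Sum>j\<in>S - {k}. c j * w j i)"
        using S(2) sum.remove[OF fin k, of "\<lambda>j. c j * w j i"] by (simp add: rep_def)
      also have "c k * w k i = - (\<Sum>j\<in>S - {k}. c j * (q j / q k * w k i))"
        by (simp add: ck sum_distrib_right sum_divide_distrib mult.assoc)
      finally show ?thesis
        by (simp add: w'_def right_diff_distrib sum_subtractf)
    qed
    moreover have "w' j i \<in> \<rat>" for j i
      unfolding w'_def using S(2) qR by (intro Rats_diff Rats_mult Rats_divide) (auto simp: rep_def)
    moreover have "w' j \<in> Rn n" for j
      using S(2) by (auto simp: rep_def w'_def Rn_iff)
    ultimately have "rep (S - {k}) c w'" using fin by (auto simp: rep_def)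
    then have "P (card (S - {k}))" by (auto simp: P_def)
    then have "Least P \<le> card (S - {k})" by (rule Least_le)
    with S(1) k fin show False by (metis card_Diff1_less not_le)
  qed
  with S(2) show ?thesis by (intro that[of S w c]) (auto simp: rep_def)
qed

lemma finite_uniform_threshold:
  fixes P :: "'a \<Rightarrow> real \<Rightarrow> bool"
  assumes "finite A" "\<And>a. a \<in> A \<Longrightarrow> \<exists>d>0. P a d"
    and "\<And>a d d'. P a d \<Longrightarrow> 0 < d' \<Longrightarrow> d' \<le> d \<Longrightarrow> P a d'"
  shows "\<exists>d>0. \<forall>a\<in>A. P a d"
  using assms(1,2)
proof induction
  case empty
  show ?case by (intro exI[of _ 1]) simp
next
  case (insert a A)
  obtain d where d: "d > 0" "\<forall>a\<in>A. P a d" using insert by auto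
  obtain d' where d': "d' > 0" "P a d'" using insert.prems[of a] by auto
  have "P b (min d d')" if "b \<in> insert a A" for b
    using that d d' assms(3)[of _ _ "min d d'"] by auto
  with d(1) d'(1) show ?case by (intro exI[of _ "min d d'"]) auto
qed

text \<open>
  The straight segment from \<open>x\<close> to \<open>y\<close> need not be definable. Instead, follow a
  rational direction close to \<open>y - x\<close> and then correct the rational coefficients one at a time.
\<close>

lemma joined_of_signs:
  assumes G: "finite G" "\<And>h. h \<in> G \<Longrightarrow> aff h"
    and x: "x \<in> Rn n" and y: "y \<in> Rn n"
    and signs: "\<And>h. h \<in> G \<Longrightarrow> h x = 0 \<or> sgn (h x) = sgn (h y)"
    and E: "E \<subseteq> Rn n" "x \<in> E" "\<And>z. z \<in> Rn n \<Longrightarrow> same_signs G z y \<Longrightarrow> z \<in> E"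
  shows "joined n E x y"
proof -
  have "(\<lambda>i. y i - x i) \<in> Rn n" using x y by (simp add: Rn_iff)
  then obtain S :: "nat set" and c w where S: "finite S" "\<And>j i. w j i \<in> \<rat>" "\<And>j. w j \<in> Rn n"
    "(\<lambda>i. y i - x i) = (\<lambda>i. \<Sum>j\<in>S. c j * w j i)"
    "\<And>h j. aff h \<Longrightarrow> h (\<lambda>i. y i - x i) = h (\<lambda>_. 0) \<Longrightarrow> j \<in> S \<Longrightarrow> h (w j) = h (\<lambda>_. 0)"
    by (rule rational_decomposition) blast
  \<comment> \<open>Points are parametrized by coefficients: \<open>x\<close> belongs to the zero
    family and \<open>y\<close> to \<open>c\<close>. All later motion takes place in this parameter
    space.\<close>
  define pt where "pt = (\<lambda>\<mu> i. x i + (\<Sum>j\<in>S. \<mu> j * w j i))"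
  have pt_Rn: "pt \<mu> \<in> Rn n" for \<mu>
    using x S(3) by (simp add: pt_def Rn_iff)
  have pt_c: "pt c = y"
  proof
    show "pt c i = y i" for i
      using fun_cong[OF S(4), of i] by (simp add: pt_def)
  qed
  have h_pt: "h (pt \<mu>) = h x + (\<Sum>j\<in>S. \<mu> j * (h (w j) - h (\<lambda>_. 0)))" if "h \<in> G" for h \<mu>
    unfolding pt_def by (rule aff_linear_combination[OF G(2)[OF that] S(1)])
  have "\<exists>d>0. \<forall>h\<in>G. \<forall>\<mu>. (\<forall>j\<in>S. \<bar>\<mu> j - c j\<bar> < d) \<longrightarrow> sgn (h (pt \<mu>)) = sgn (h y)"
  proof (rule finite_uniform_threshold[OF G(1)])
    fix h assume h: "h \<in> G"
    define q where "q = (\<lambda>j. h (w j) - h (\<lambda>_. 0))"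
    show "\<exists>d>0. \<forall>\<mu>. (\<forall>j\<in>S. \<bar>\<mu> j - c j\<bar> < d) \<longrightarrow> sgn (h (pt \<mu>)) = sgn (h y)"
    proof (cases "h y = 0")
      case True
      \<comment> \<open>An equation holding at \<open>y\<close> cannot survive a perturbation unless
        all directions preserve it. Here \<open>h\<close> vanishes at both ends, so its linear part
        kills \<open>y - x\<close> and, by the choice of the decomposition, every
        \<open>w j\<close>.\<close>
      then have "h x = 0" using signs[OF h] by (auto simp: sgn_0_0)
      moreover have "h (\<lambda>i. x i + 1 * (y i - x i)) = h x + 1 * (h (\<lambda>i. y i - x i) - h (\<lambda>_. 0))"
        by (rule aff_line[OF G(2)[OF h]])
      ultimately have "h (\<lambda>i. y i - x i) = h (\<lambda>_. 0)" using True by simp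
      then have "h (w j) = h (\<lambda>_. 0)" if "j \<in> S" for j
        using S(5)[OF G(2)[OF h]] that by blast
      then have "h (pt \<mu>) = 0" for \<mu>
        using h_pt[OF h] \<open>h x = 0\<close> by simp
      with True show ?thesis by (intro exI[of _ 1]) simp
    next
      case False
      \<comment> \<open>A change of every coefficient by less than
        \<open>\<bar>h y\<bar> / Q\<close> moves \<open>h\<close> by less than
        \<open>\<bar>h y\<bar>\<close>. The summand 1 keeps \<open>Q\<close> positive and this
        estimate strict.\<close>
      define Q where "Q = 1 + (\<Sum>j\<in>S. \<bar>q j\<bar>)"
      have Q: "Q > 0" unfolding Q_def by (simp add: add_pos_nonneg sum_nonneg)
      have "sgn (h (pt \<mu>)) = sgn (h y)" if \<mu>: "\<forall>j\<in>S. \<bar>\<mu> j - c j\<bar> < \<bar>h y\<bar> / Q" for \<mu>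
      proof -
        have "h (pt \<mu>) - h y = (\<Sum>j\<in>S. (\<mu> j - c j) * q j)"
          using h_pt[OF h, of \<mu>] h_pt[OF h, of c]
          by (simp add: pt_c q_def left_diff_distrib sum_subtractf)
        also have "\<bar>\<dots>\<bar> \<le> (\<Sum>j\<in>S. \<bar>\<mu> j - c j\<bar> * \<bar>q j\<bar>)"
          by (rule order_trans[OF sum_abs]) (simp add: abs_mult)
        also have "\<dots> \<le> (\<Sum>j\<in>S. \<bar>h y\<bar> / Q * \<bar>q j\<bar>)"
          using \<mu> by (intro sum_mono mult_right_mono) (auto intro: less_imp_le)
        also have "\<dots> = \<bar>h y\<bar> / Q * (Q - 1)"
          by (simp add: Q_def sum_distrib_left)
        also have "\<dots> < \<bar>h y\<bar>"
          using Q False by (simp add: field_simps)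
        finally have "\<bar>h (pt \<mu>) - h y\<bar> < \<bar>h y\<bar>" .
        then show ?thesis by (auto simp: sgn_real_def)
      qed
      with Q False show ?thesis by (intro exI[of _ "\<bar>h y\<bar> / Q"]) auto
    qed
  qed (meson less_le_trans)
  then obtain d where d: "d > 0"
    "\<And>h \<mu>. h \<in> G \<Longrightarrow> (\<forall>j\<in>S. \<bar>\<mu> j - c j\<bar> < d) \<Longrightarrow> sgn (h (pt \<mu>)) = sgn (h y)"
    by blast
  have near: "pt \<mu> \<in> E" if "\<forall>j\<in>S. \<bar>\<mu> j - c j\<bar> < d" for \<mu>
    using E(3)[OF pt_Rn] d(2)[OF _ that] by (simp add: same_signs_def)
  have "\<exists>r. r \<in> \<rat> \<and> \<bar>r - c j\<bar> < d" for j
  proof -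
    obtain r where "r \<in> \<rat>" "c j < r" "r < c j + d"
      using Rats_dense_in_real[of "c j" "c j + d"] d(1) by auto
    then show ?thesis by (intro exI[of _ r]) auto
  qed
  then obtain \<rho> where \<rho>: "\<And>j. \<rho> j \<in> \<rat>" "\<And>j. \<bar>\<rho> j - c j\<bar> < d" by metis
  have "joined n E x (\<lambda>i. x i + 1 * (\<Sum>j\<in>S. \<rho> j * w j i))"
  proof (rule joined_segment[OF E(1)])
    show "(\<Sum>j\<in>S. \<rho> j * w j i) \<in> \<rat>" for i
      using \<rho>(1) S(2) by (intro Rats_sum Rats_mult)
    fix t :: real assume t: "0 \<le> t" "t \<le> 1"
    let ?z = "\<lambda>i. x i + t * (\<Sum>j\<in>S. \<rho> j * w j i)"
    show "?z \<in> E"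
    proof (cases "t = 0")
      case True
      then show ?thesis using E(2) by simp
    next
      case False
      have z: "?z = pt (\<lambda>j. t * \<rho> j)"
        by (simp add: pt_def sum_distrib_left mult.assoc)
      have "sgn (h ?z) = sgn (h y)" if h: "h \<in> G" for h
      proof -
        have \<rho>y: "sgn (h (pt \<rho>)) = sgn (h y)" using d(2)[OF h] \<rho>(2) by blast
        \<comment> \<open>A convex combination of \<open>h x\<close>, which is 0 or has the sign of
          \<open>h y\<close>, and \<open>h (pt \<rho>)\<close>, which has the sign of
          \<open>h y\<close>. For \<open>t > 0\<close> the second term is effective, so the segment
          enters the cell immediately.\<close>
        have "h (pt (\<lambda>j. t * \<rho> j)) = (1 - t) * h x + t * h (pt \<rho>)"
          unfolding h_pt[OF h] by (simp add: algebra_simps sum_distrib_left)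
        then have eq: "h ?z = (1 - t) * h x + t * h (pt \<rho>)" by (simp only: z)
        from signs[OF h] show ?thesis
        proof
          assume "h x = 0"
          then show ?thesis using eq \<rho>y t False by (simp add: sgn_mult)
        next
          assume "sgn (h x) = sgn (h y)"
          then consider "h x = 0" "h (pt \<rho>) = 0" "h y = 0" | "h x > 0" "h (pt \<rho>) > 0" "h y > 0"
            | "h x < 0" "h (pt \<rho>) < 0" "h y < 0"
            using \<rho>y by (auto simp: sgn_real_def split: if_splits)
          then show ?thesis
          proof cases
            case 2
            then have "h ?z > 0" unfolding eq using t False
              by (intro add_nonneg_pos mult_nonneg_nonneg mult_pos_pos) auto
            with 2 show ?thesis by simp
          next
            case 3
            then have "(1 - t) * h x \<le> 0" "t * h (pt \<rho>) < 0" using t False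
              by (simp_all add: mult_nonneg_nonpos mult_pos_neg)
            then have "h ?z < 0" unfolding eq by linarith
            with 3 show ?thesis by simp
          qed (simp add: eq)
        qed
      qed
      then have "same_signs G ?z y" by (simp add: same_signs_def)
      moreover have "?z \<in> Rn n" unfolding z by (rule pt_Rn)
      ultimately show ?thesis using E(3) by blast
    qed
  qed simp
  then have 1: "joined n E x (pt \<rho>)" by (simp add: pt_def)
  \<comment> \<open>Each correction runs along the rational vector \<open>w k\<close>, or its
    negative, for the possibly irrational time \<open>\<bar>c k - \<rho> k\<bar>\<close>, which is
    just a parameter. All coefficients stay within \<open>d\<close> of \<open>c\<close>, so the path
    does not leave \<open>E\<close>.\<close>
  have "joined n E (pt \<rho>) (pt (\<lambda>j. if j \<in> T then c j else \<rho> j))" if "finite T" "T \<subseteq> S" for T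
    using that
  proof induction
    case empty
    have "pt \<rho> \<in> E" using near \<rho>(2) by blast
    then show ?case using joined_refl[OF E(1)] by simp
  next
    case (insert k T)
    define \<mu> where "\<mu> = (\<lambda>j. if j \<in> T then c j else \<rho> j)"
    define s where "s = \<bar>c k - \<rho> k\<bar>"
    define \<sigma> where "\<sigma> = (if c k < \<rho> k then - 1 else 1 :: real)"
    have k: "k \<in> S" "k \<notin> T" using insert by auto
    have step: "(\<lambda>i. pt \<mu> i + t * (\<sigma> * w k i)) = pt (\<mu>(k := \<rho> k + t * \<sigma>))" for t
    proof
      fix i
      let ?\<nu> = "\<mu>(k := \<rho> k + t * \<sigma>)"
      have "(\<Sum>j\<in>S - {k}. ?\<nu> j * w j i) = (\<Sum>j\<in>S - {k}. \<mu> j * w j i)"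
        by (intro sum.cong) auto
      then show "pt \<mu> i + t * (\<sigma> * w k i) = pt ?\<nu> i"
        using sum.remove[OF S(1) k(1), of "\<lambda>j. \<mu> j * w j i"]
          sum.remove[OF S(1) k(1), of "\<lambda>j. ?\<nu> j * w j i"] k(2)
        by (simp add: pt_def \<mu>_def algebra_simps)
    qed
    have "joined n E (pt \<mu>) (\<lambda>i. pt \<mu> i + s * (\<sigma> * w k i))"
    proof (rule joined_segment[OF E(1)])
      show "\<sigma> * w k i \<in> \<rat>" for i using S(2) by (auto simp: \<sigma>_def)
      fix t assume t: "0 \<le> t" "t \<le> s"
      then have "\<bar>\<rho> k + t * \<sigma> - c k\<bar> < d"
        using \<rho>(2)[of k] by (auto simp: \<sigma>_def s_def split: if_splits)
      then show "(\<lambda>i. pt \<mu> i + t * (\<sigma> * w k i)) \<in> E"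
        unfolding step using d(1) \<rho>(2) by (intro near) (simp add: \<mu>_def)
    qed (simp add: s_def)
    moreover have "\<mu>(k := \<rho> k + s * \<sigma>) = (\<lambda>j. if j \<in> insert k T then c j else \<rho> j)"
      by (auto simp: \<mu>_def s_def \<sigma>_def fun_eq_iff)
    ultimately have "joined n E (pt \<mu>) (pt (\<lambda>j. if j \<in> insert k T then c j else \<rho> j))"
      unfolding step by simp
    moreover have "joined n E (pt \<rho>) (pt \<mu>)"
      unfolding \<mu>_def using insert by simp
    ultimately show ?case using joined_trans[OF E(1)] by blast
  qed
  from this[OF S(1) order_refl]
  have "joined n E (pt \<rho>) (pt (\<lambda>j. if j \<in> S then c j else \<rho> j))" .
  moreover have "pt (\<lambda>j. if j \<in> S then c j else \<rho> j) = pt c"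
    by (simp add: pt_def cong: sum.cong)
  ultimately show ?thesis
    using joined_trans[OF E(1) 1] by (simp add: pt_c)
qed

section \<open>Cells and connected components\<close>

lemma frc_eq: "frc x = (\<lambda>i. x i - flr x i)"
  by (simp add: frc_def flr_def frac_def)

lemma flr_in_Ints: "flr x i \<in> \<int>"
  by (simp add: flr_def)

text \<open>By convexity, this means that \<open>x\<close> lies in the closure of the cell of \<open>y\<close>.\<close>

definition adjacent :: "((nat \<Rightarrow> real) \<Rightarrow> real) set \<Rightarrow> (nat \<Rightarrow> real) \<Rightarrow> (nat \<Rightarrow> real) \<Rightarrow> bool"
  where "adjacent H x y \<longleftrightarrow> (\<forall>h\<in>H. h (\<lambda>i. x i - flr y i) = 0 \<or>
    sgn (h (\<lambda>i. x i - flr y i)) = sgn (h (frc y)))"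

text \<open>By \<open>aff_integral\<close> the values \<open>h (x - m)\<close> lie in a translate of
  the multiples of \<open>1 / D\<close>, so those different from 0 stay away from 0.\<close>

lemma aff_integer_shift_gap:
  assumes "aff h"
  shows "\<exists>d>0. \<forall>m. (\<forall>i. m i \<in> \<int>) \<longrightarrow> h (\<lambda>i. x i - m i) = 0 \<or> d \<le> \<bar>h (\<lambda>i. x i - m i)\<bar>"
proof -
  obtain D where D: "D > 0" "\<And>m. (\<forall>i. m i \<in> \<int>) \<Longrightarrow> real D * (h m - h (\<lambda>_. 0)) \<in> \<int>"
    using aff_integral[OF assms] by blast
  define a where "a = real D * h x"
  \<comment> \<open>\<open>g\<close> is a lower bound for the nonzero distances from
    \<open>a\<close> to integers: the distance to the nearest integer if \<open>a\<close> is not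
    one, and 1 otherwise.\<close>
  define g where "g = (if a \<in> \<int> then 1 else min (frac a) (1 - frac a))"
  have g: "g > 0" by (auto simp: g_def frac_gt_0_iff frac_lt_1)
  have gap: "a = real_of_int k \<or> g \<le> \<bar>a - real_of_int k\<bar>" for k
  proof (cases "a \<in> \<int>")
    case True
    then obtain l where "a = real_of_int l" by (auto elim: Ints_cases)
    then have "a = real_of_int k \<or> 1 \<le> \<bar>a - real_of_int k\<bar>" by (auto simp: abs_if)
    with True show ?thesis by (simp add: g_def)
  next
    case False
    then have g: "g = min (frac a) (1 - frac a)" by (simp add: g_def)
    consider "k \<le> \<lfloor>a\<rfloor>" | "\<lfloor>a\<rfloor> + 1 \<le> k" by linarith
    then show ?thesis
    proof cases
      case 1
      then have "frac a \<le> a - real_of_int k" unfolding frac_def by linarith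
      then show ?thesis unfolding g by linarith
    next
      case 2
      then have "1 - frac a \<le> real_of_int k - a" unfolding frac_def by linarith
      then show ?thesis unfolding g by linarith
    qed
  qed
  have "h (\<lambda>i. x i - m i) = 0 \<or> g / real D \<le> \<bar>h (\<lambda>i. x i - m i)\<bar>" if m: "\<forall>i. m i \<in> \<int>" for m
  proof -
    obtain k where k: "real D * (h m - h (\<lambda>_. 0)) = real_of_int k"
      using D(2)[OF m] by (auto elim: Ints_cases)
    have "h (\<lambda>i. x i - m i) = h x - (h m - h (\<lambda>_. 0))"
      using aff_line[OF assms, of x "- 1" m] by simp
    then have "real D * h (\<lambda>i. x i - m i) = a - real_of_int k"
      by (simp only: right_diff_distrib[of _ "h x"] a_def k)
    moreover from this have "real D * \<bar>h (\<lambda>i. x i - m i)\<bar> = \<bar>a - real_of_int k\<bar>"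
      by (metis abs_mult abs_of_nat)
    ultimately show ?thesis using gap[of k] D(1) by (auto simp: field_simps)
  qed
  with g D(1) show ?thesis by (intro exI[of _ "g / real D"]) auto
qed

text \<open>The arguments \<open>x - flr y\<close> and \<open>frc y = y - flr y\<close> differ by
  \<open>x - y\<close>. If \<open>y\<close> is so close that \<open>h\<close> varies by less than
  the gap, a nonzero \<open>h (x - flr y)\<close> keeps its sign, whichever unit cube contains
  \<open>y\<close>.\<close>

lemma adjacent_nearby:
  assumes "finite H" "\<And>h. h \<in> H \<Longrightarrow> aff h" "x \<in> Rn n"
  shows "\<exists>d>0. \<forall>y\<in>Rn n. (\<forall>i<n. \<bar>y i - x i\<bar> < d) \<longrightarrow> adjacent H x y"
proof -
  have "\<exists>d>0. \<forall>h\<in>H. \<forall>y\<in>Rn n. (\<forall>i<n. \<bar>y i - x i\<bar> < d) \<longrightarrow>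
      h (\<lambda>i. x i - flr y i) = 0 \<or> sgn (h (\<lambda>i. x i - flr y i)) = sgn (h (frc y))"
  proof (rule finite_uniform_threshold[OF assms(1)])
    fix h assume "h \<in> H"
    then have h: "aff h" by (rule assms(2))
    obtain g where g: "g > 0"
        "\<And>m. (\<forall>i. m i \<in> \<int>) \<Longrightarrow> h (\<lambda>i. x i - m i) = 0 \<or> g \<le> \<bar>h (\<lambda>i. x i - m i)\<bar>"
      using aff_integer_shift_gap[OF h] by blast
    obtain K where K: "K \<ge> 0" "\<And>u v d. (\<forall>i. \<bar>u i - v i\<bar> \<le> d) \<Longrightarrow> \<bar>h u - h v\<bar> \<le> K * d"
      using aff_lipschitz[OF h] by blast
    \<comment> \<open>Dividing by \<open>K + 1\<close> keeps the radius defined when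
      \<open>K = 0\<close> and makes \<open>K * ?d < g\<close> strict.\<close>
    let ?d = "g / (K + 1)"
    have d: "?d > 0" "K * ?d < g" using g(1) K(1) by (auto simp: field_simps)
    have "h (\<lambda>i. x i - flr y i) = 0 \<or> sgn (h (\<lambda>i. x i - flr y i)) = sgn (h (frc y))"
      if y: "y \<in> Rn n" "\<forall>i<n. \<bar>y i - x i\<bar> < ?d" for y
    proof -
      have "\<bar>(x i - flr y i) - frc y i\<bar> \<le> ?d" for i
        using y assms(3) d(1) by (cases "i < n") (auto simp: frc_eq Rn_iff abs_minus_commute)
      then have "\<bar>h (\<lambda>i. x i - flr y i) - h (frc y)\<bar> \<le> K * ?d" by (intro K(2)) simp
      moreover have "h (\<lambda>i. x i - flr y i) = 0 \<or> g \<le> \<bar>h (\<lambda>i. x i - flr y i)\<bar>"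
        by (rule g(2)) (simp add: flr_in_Ints)
      ultimately show ?thesis using d(2) by (auto simp: sgn_real_def)
    qed
    with d(1) show "\<exists>d>0. \<forall>y\<in>Rn n. (\<forall>i<n. \<bar>y i - x i\<bar> < d) \<longrightarrow>
      h (\<lambda>i. x i - flr y i) = 0 \<or> sgn (h (\<lambda>i. x i - flr y i)) = sgn (h (frc y))"
      by blast
  qed (meson less_le_trans)
  then show ?thesis unfolding adjacent_def by blast
qed

lemma openin_Euclidean_box:
  "openin (Euclidean_space n) {y \<in> Rn n. \<forall>i<n. \<bar>y i - x i\<bar> < d}"
proof -
  have "openin (Euclidean_space n) {y \<in> Rn n. \<bar>y i - x i\<bar> < d}" if "i < n" for i
  proof -
    have "continuous_map (Euclidean_space n) euclideanreal (\<lambda>y. y i)"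
      unfolding Euclidean_space_def
      by (intro continuous_map_from_subtopology continuous_map_product_projection) simp
    then have "continuous_map (Euclidean_space n) euclideanreal (\<lambda>y. \<bar>y i - x i\<bar>)"
      by (intro continuous_intros) auto
    from openin_continuous_map_preimage[OF this, of "{..<d}"] show ?thesis by simp
  qed
  then have "openin (Euclidean_space n) (Rn n \<inter> (\<Inter>i\<in>{..<n}. {y \<in> Rn n. \<bar>y i - x i\<bar> < d}))"
    by (intro openin_Int_Inter) auto
  moreover have "Rn n \<inter> (\<Inter>i\<in>{..<n}. {y \<in> Rn n. \<bar>y i - x i\<bar> < d})
      = {y \<in> Rn n. \<forall>i<n. \<bar>y i - x i\<bar> < d}" by auto
  ultimately show ?thesis by simp
qed

lemma openin_locally_constant:
  assumes "E \<subseteq> Rn n"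
    and "\<And>x. x \<in> E \<Longrightarrow> \<exists>d>0. \<forall>y\<in>E. (\<forall>i<n. \<bar>y i - x i\<bar> < d) \<longrightarrow> (P y \<longleftrightarrow> P x)"
  shows "openin (subtopology (Euclidean_space n) E) {x \<in> E. P x}"
proof (subst openin_subopen, intro ballI)
  fix x assume "x \<in> {x \<in> E. P x}"
  then have x: "x \<in> E" "P x" by auto
  then obtain d where d: "d > 0" "\<And>y. y \<in> E \<Longrightarrow> (\<forall>i<n. \<bar>y i - x i\<bar> < d) \<Longrightarrow> P y \<longleftrightarrow> P x"
    using assms(2) by blast
  let ?U = "{y \<in> Rn n. \<forall>i<n. \<bar>y i - x i\<bar> < d}"
  have "openin (subtopology (Euclidean_space n) E) (?U \<inter> E)"
    using openin_Euclidean_box by (rule openin_subtopology_Int)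
  moreover have "x \<in> ?U \<inter> E" using x d(1) assms(1) by auto
  moreover have "?U \<inter> E \<subseteq> {x \<in> E. P x}" using d(2) x(2) by auto
  ultimately show "\<exists>T. openin (subtopology (Euclidean_space n) E) T \<and> x \<in> T \<and> T \<subseteq> {x \<in> E. P x}"
    by blast
qed

text \<open>The functions required by \<open>coord_H\<close> test whether a point lies in the
  half-open unit cube with a given integer corner. Hence equality of floors can itself be read off
  from sign conditions.\<close>

locale cell_decomposition =
  fixes n :: nat and H :: "((nat \<Rightarrow> real) \<Rightarrow> real) set" and E :: "(nat \<Rightarrow> real) set"
  assumes finite_H: "finite H"
    and aff_H: "h \<in> H \<Longrightarrow> aff h"
    and coord_H: "i < n \<Longrightarrow> (\<lambda>x. x i) \<in> H" "i < n \<Longrightarrow> (\<lambda>x. x i - 1) \<in> H"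
    and E_subset: "E \<subseteq> Rn n"
    and saturated: "\<lbrakk>x \<in> E; y \<in> Rn n; flr x = flr y; same_signs H (frc x) (frc y)\<rbrakk> \<Longrightarrow> y \<in> E"
begin

lemma cell_of_signs:
  assumes "y \<in> Rn n" "z \<in> Rn n" "\<And>h. h \<in> H \<Longrightarrow> sgn (h (\<lambda>i. z i - flr y i)) = sgn (h (frc y))"
  shows "flr y = flr z" "same_signs H (frc y) (frc z)"
proof -
  have "flr y i = flr z i" for i
  proof (cases "i < n")
    case True
    have "frc y i \<ge> 0" "frc y i - 1 < 0" by (auto simp: frc_def frac_lt_1)
    moreover have "sgn (z i - flr y i) = sgn (frc y i)" "sgn (z i - flr y i - 1) = sgn (frc y i - 1)"
      using assms(3)[OF coord_H(1)[OF True]] assms(3)[OF coord_H(2)[OF True]] by simp_all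
    ultimately have "z i - flr y i \<ge> 0" "z i - flr y i - 1 < 0"
      by (auto simp: sgn_real_def split: if_splits)
    then have "\<lfloor>z i\<rfloor> = \<lfloor>y i\<rfloor>" unfolding flr_def by linarith
    then show ?thesis by (simp add: flr_def)
  qed (use assms(1,2) in \<open>simp add: Rn_iff flr_def\<close>)
  then show flr: "flr y = flr z" ..
  have "(\<lambda>i. z i - flr y i) = frc z" by (simp add: frc_eq flr)
  with assms(3) show "same_signs H (frc y) (frc z)"
    by (simp add: same_signs_def)
qed

lemma adjacent_joined:
  assumes "x \<in> E" "y \<in> E" "adjacent H x y"
  shows "joined n E x y"
proof (rule joined_of_signs)
  \<comment> \<open>Translating the conditions by the constant \<open>flr y\<close> turns the cell
    of \<open>y\<close> into a set given by signs of affine functions of \<open>z\<close> itself,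
    with no floor of \<open>z\<close> involved.\<close>
  let ?G = "(\<lambda>h z. h (\<lambda>i. z i - flr y i)) ` H"
  show "finite ?G" using finite_H by simp
  show "aff g" if g: "g \<in> ?G" for g
  proof -
    obtain h where h: "h \<in> H" "g = (\<lambda>z. h (\<lambda>i. z i - flr y i))" using g by auto
    show ?thesis
      unfolding h(2) by (rule aff_subst[OF aff_H[OF h(1)]]) (intro aff_diff aff_var aff_const)
  qed
  show "x \<in> Rn n" "y \<in> Rn n" "E \<subseteq> Rn n" "x \<in> E" using assms E_subset by auto
  show "g x = 0 \<or> sgn (g x) = sgn (g y)" if "g \<in> ?G" for g
    using that assms(3) by (auto simp: adjacent_def frc_eq)
  show "z \<in> E" if z: "z \<in> Rn n" "same_signs ?G z y" for z
  proof -
    have "sgn (h (\<lambda>i. z i - flr y i)) = sgn (h (frc y))" if "h \<in> H" for h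
      using z(2) that by (simp add: same_signs_def frc_eq)
    from cell_of_signs[OF \<open>y \<in> Rn n\<close> z(1) this] show ?thesis
      using saturated[OF assms(2) z(1)] by blast
  qed
qed

section \<open>Classes generated by adjacency, and connected components\<close>

definition chained :: "(nat \<Rightarrow> real) \<Rightarrow> (nat \<Rightarrow> real) \<Rightarrow> bool"
  where "chained = (\<lambda>x y. x \<in> E \<and> y \<in> E \<and> (adjacent H x y \<or> adjacent H y x))\<^sup>*\<^sup>*"

lemma chained_step: "x \<in> E \<Longrightarrow> y \<in> E \<Longrightarrow> adjacent H x y \<or> adjacent H y x \<Longrightarrow> chained x y"
  unfolding chained_def by (rule r_into_rtranclp) blast

lemma chained_trans: "chained x y \<Longrightarrow> chained y z \<Longrightarrow> chained x z"
  unfolding chained_def by (rule rtranclp_trans)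

lemma chained_joined:
  assumes "chained x y" "x \<in> E"
  shows "joined n E x y"
  using assms(1) unfolding chained_def
proof (induction rule: rtranclp_induct)
  case base
  show ?case using E_subset assms(2) by (rule joined_refl)
next
  case (step y z)
  then have "joined n E y z"
    using adjacent_joined joined_sym[OF E_subset] by blast
  with step.IH show ?case by (rule joined_trans[OF E_subset])
qed

lemma clopen_chained:
  "openin (subtopology (Euclidean_space n) E) {z \<in> E. chained x z}"
  "closedin (subtopology (Euclidean_space n) E) {z \<in> E. chained x z}"
proof -
  have *: "\<exists>d>0. \<forall>y\<in>E. (\<forall>i<n. \<bar>y i - z i\<bar> < d) \<longrightarrow> (chained x y \<longleftrightarrow> chained x z)"
    if z: "z \<in> E" for z
  proof -
    obtain d where d: "d > 0" "\<And>y. y \<in> Rn n \<Longrightarrow> (\<forall>i<n. \<bar>y i - z i\<bar> < d) \<Longrightarrow> adjacent H z y"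
      using adjacent_nearby[OF finite_H aff_H, of z n] z E_subset by blast
    have "chained x y \<longleftrightarrow> chained x z" if y: "y \<in> E" "\<forall>i<n. \<bar>y i - z i\<bar> < d" for y
    proof -
      have "adjacent H z y" using d(2) y E_subset by blast
      then have "chained z y" "chained y z" using chained_step z y(1) by blast+
      then show ?thesis using chained_trans by blast
    qed
    with d(1) show ?thesis by blast
  qed
  then show "openin (subtopology (Euclidean_space n) E) {z \<in> E. chained x z}"
    by (rule openin_locally_constant[OF E_subset])
  have "openin (subtopology (Euclidean_space n) E) {z \<in> E. \<not> chained x z}"
    by (rule openin_locally_constant[OF E_subset]) (use * in metis)
  moreover have "topspace (subtopology (Euclidean_space n) E) - {z \<in> E. chained x z} = {z \<in> E. \<not> chained x z}"
    using E_subset by auto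
  ultimately show "closedin (subtopology (Euclidean_space n) E) {z \<in> E. chained x z}"
    using E_subset by (auto simp: closedin_def)
qed

lemma connectedin_subset_chained:
  assumes "connectedin (subtopology (Euclidean_space n) E) C" "x \<in> C"
  shows "C \<subseteq> {z \<in> E. chained x z}"
proof -
  have "x \<in> E" using assms by (auto simp: connectedin_subtopology)
  then have "x \<in> {z \<in> E. chained x z}" by (simp add: chained_def)
  with assms(2) connectedin_clopen_cases[OF assms(1) clopen_chained(2) clopen_chained(1), of x]
  show ?thesis by (auto simp: disjnt_def)
qed

lemma connected_joined:
  assumes "connectedin (Euclidean_space n) E" "x \<in> E" "y \<in> E"
  shows "joined n E x y"
  using connectedin_subset_chained[of E x] assms chained_joined[of x y]
  by (auto simp: connectedin_subtopology)

lemma component_eq_chained: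
  assumes C: "C \<in> connected_components_of (subtopology (Euclidean_space n) E)" and x: "x \<in> C"
  shows "C = {z \<in> E. chained x z}"
proof
  have "connectedin (subtopology (Euclidean_space n) E) C"
    using C by (rule connectedin_connected_components_of)
  then show "C \<subseteq> {z \<in> E. chained x z}"
    using connectedin_subset_chained x by blast
  then have xE: "x \<in> E" using x by blast
  show "{z \<in> E. chained x z} \<subseteq> C"
  proof
    fix z assume "z \<in> {z \<in> E. chained x z}"
    then obtain P where "connectedin (subtopology (Euclidean_space n) E) P" "x \<in> P" "z \<in> P"
      using joined_connectedin[OF E_subset chained_joined] xE by blast
    then show "z \<in> C"
      using connected_components_of_maximal[OF C] x by (auto simp: disjnt_def)
  qed
qed

end

section \<open>Coding finite sets of natural numbers\<close>

definition dvd_real :: "real \<Rightarrow> real \<Rightarrow> bool"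
  where "dvd_real x y \<longleftrightarrow> (\<exists>m d. x = real m \<and> y = real (d * m))"

lemma dvd_real_of_nat [simp]: "dvd_real (real m) (real k) \<longleftrightarrow> m dvd k"
  by (auto simp: dvd_real_def dvd_def mult.commute simp flip: of_nat_mult)

lemma Nats_iff_dvd_real: "x \<in> \<nat> \<longleftrightarrow> dvd_real x x"
proof
  assume "x \<in> \<nat>"
  then show "dvd_real x x" by (auto elim!: Nats_cases)
qed (auto simp: dvd_real_def)

text \<open>Since \<open>m\<close> and \<open>m + 1\<close> are coprime, their least common multiple
  is \<open>m * (m + 1)\<close>, that is, \<open>m\<^sup>2 + m\<close>.\<close>

lemma square_via_dvd:
  fixes m r :: nat
  assumes "m > 0"
  shows "r = m\<^sup>2 \<longleftrightarrow> m dvd r + m \<and> m + 1 dvd r + m \<and> (\<forall>s>0. m dvd s \<and> m + 1 dvd s \<longrightarrow> r + m \<le> s)"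
    (is "_ \<longleftrightarrow> ?R")
proof -
  have common: "m dvd s \<and> m + 1 dvd s \<longleftrightarrow> m * (m + 1) dvd s" for s
    using divides_mult[of m s "m + 1"] coprime_Suc_right_nat[of m]
      dvd_mult_left[of m "m + 1" s] dvd_mult_right[of m "m + 1" s] by auto
  have sq: "m\<^sup>2 + m = m * (m + 1)" by (simp add: power2_eq_square)
  show ?thesis
  proof
    assume r: "r = m\<^sup>2"
    have "m dvd r + m \<and> m + 1 dvd r + m" unfolding common r sq by simp
    moreover have "r + m \<le> s" if "s > 0" "m dvd s \<and> m + 1 dvd s" for s
      using that(1) that(2)[unfolded common] unfolding r sq by (rule dvd_imp_le[rotated])
    ultimately show ?R by blast
  next
    assume R: ?R
    then have "m * (m + 1) dvd r + m" using common[of "r + m"] by blast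
    then have "m * (m + 1) \<le> r + m" using assms by (intro dvd_imp_le) auto
    moreover have "r + m \<le> m * (m + 1)" using R common[of "m * (m + 1)"] assms by auto
    ultimately show "r = m\<^sup>2" unfolding power2_eq_square by simp
  qed
qed

definition nat_square :: "real \<Rightarrow> real"
  where "nat_square x = (if x \<in> \<nat> then x\<^sup>2 else 0)"

lemma nat_square_of_nat [simp]: "nat_square (real m) = real (m\<^sup>2)"
  by (simp add: nat_square_def)

text \<open>Although \<open>s\<close> ranges over the reals, \<open>dvd_real x s\<close> forces it
  to be natural. Zero is split off because it has no positive multiple.\<close>

lemma nat_square_iff:
  "r = nat_square x \<longleftrightarrow>
    (x \<notin> \<nat> \<or> x = 0) \<and> r = 0 \<or>
    x \<in> \<nat> \<and> x \<noteq> 0 \<and> r \<in> \<nat> \<and> dvd_real x (r + x) \<and> dvd_real (x + 1) (r + x) \<and>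
      (\<forall>s. 0 < s \<and> dvd_real x s \<and> dvd_real (x + 1) s \<longrightarrow> r + x \<le> s)"
proof (cases "x \<in> \<nat> \<and> x \<noteq> 0")
  case False
  then show ?thesis by (auto simp: nat_square_def)
next
  case True
  then obtain m where m: "x = real m" "m > 0" by (auto elim!: Nats_cases)
  have sum: "real k + x = real (k + m)" "x + 1 = real (m + 1)" for k using m by auto
  show ?thesis
  proof (cases "r \<in> \<nat>")
    case False
    moreover have "nat_square x \<in> \<nat>" unfolding m nat_square_of_nat by (rule of_nat_in_Nats)
    ultimately show ?thesis using True by auto
  next
    case rN: True
    then obtain k where k: "r = real k" by (auto elim: Nats_cases)
    have dx: "dvd_real x (real j) \<longleftrightarrow> m dvd j" "dvd_real (x + 1) (real j) \<longleftrightarrow> m + 1 dvd j" for j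
      unfolding sum by (simp only: m dvd_real_of_nat, rule dvd_real_of_nat)
    have "(\<forall>s. 0 < s \<and> dvd_real x s \<and> dvd_real (x + 1) s \<longrightarrow> r + x \<le> s) \<longleftrightarrow>
        (\<forall>s>0. m dvd s \<and> m + 1 dvd s \<longrightarrow> k + m \<le> s)" (is "?L \<longleftrightarrow> ?R")
    proof
      assume L: ?L
      show ?R
      proof (intro allI impI)
        fix s :: nat assume "s > 0" "m dvd s \<and> m + 1 dvd s"
        with L[rule_format, of "real s"] dx[of s] have "r + x \<le> real s" by simp
        then show "k + m \<le> s" unfolding k sum by simp
      qed
    next
      assume R: ?R
      show ?L
      proof (intro allI impI)
        fix s assume s: "0 < s \<and> dvd_real x s \<and> dvd_real (x + 1) s"
        then obtain j where j: "s = real j" unfolding dvd_real_def by blast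
        with s dx[of j] R have "k + m \<le> j" by simp
        then show "r + x \<le> s" unfolding k sum j by simp
      qed
    qed
    moreover have "r = nat_square x \<longleftrightarrow> k = m\<^sup>2"
      unfolding k m nat_square_of_nat by (rule of_nat_eq_iff)
    ultimately show ?thesis
      using True rN square_via_dvd[OF m(2), of k] dx[of "k + m"] by (simp add: k sum)
  qed
qed

text \<open>Polarization: multiplication is recovered from squaring, using only addition and the
  rational factor 1/2.\<close>

definition nat_mult :: "real \<Rightarrow> real \<Rightarrow> real"
  where "nat_mult x y = (1 / 2) * (nat_square (x + y) - nat_square x - nat_square y)"

lemma nat_mult_of_nat [simp]: "nat_mult (real k) (real m) = real (k * m)"
proof -
  have "real k + real m = real (k + m)" by simp
  then have "nat_square (real k + real m) = (real k + real m)\<^sup>2"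
    by (metis nat_square_of_nat of_nat_power)
  then show ?thesis by (simp add: nat_mult_def power2_sum)
qed

definition nat_pair :: "real \<Rightarrow> real \<Rightarrow> real"
  where "nat_pair x y = nat_square (x + y) + x"

lemma nat_pair_of_nat [simp]: "nat_pair (real k) (real m) = real ((k + m)\<^sup>2 + k)"
proof -
  have "nat_square (real k + real m) = real ((k + m)\<^sup>2)" by (metis nat_square_of_nat of_nat_add)
  then show ?thesis by (simp add: nat_pair_def)
qed

text \<open>With s = k + m, the added \<open>k\<close> is at most s and hence smaller than the
  distance 2s + 1 to the next square. So the code determines s, then \<open>k\<close>, then
  \<open>m\<close>.\<close>

lemma square_add_inj:
  fixes k m k' m' :: nat
  assumes "(k + m)\<^sup>2 + k = (k' + m')\<^sup>2 + k'"
  shows "k = k' \<and> m = m'"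
proof -
  have "\<not> a + b < a' + b'" if "(a + b)\<^sup>2 + a = (a' + b')\<^sup>2 + a'" for a b a' b' :: nat
  proof
    assume "a + b < a' + b'"
    then have "(a + b + 1)\<^sup>2 \<le> (a' + b')\<^sup>2" by (intro power_mono) auto
    with that show False by (simp add: power2_eq_square)
  qed
  from this[OF assms] this[OF assms[symmetric]] have "k + m = k' + m'" by simp
  with assms show ?thesis by simp
qed

primrec nat_list_code :: "real list \<Rightarrow> real"
  where
    "nat_list_code [] = 0"
  | "nat_list_code (x # xs) = nat_pair x (nat_list_code xs)"

lemma nat_list_code_Nats: "set xs \<subseteq> \<nat> \<Longrightarrow> nat_list_code xs \<in> \<nat>"
proof (induction xs)
  case (Cons x xs)
  then obtain k m where "x = real k" "nat_list_code xs = real m"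
    by (auto elim!: Nats_cases)
  then show ?case by (simp del: of_nat_add of_nat_power)
qed simp

text \<open>Lengths must agree: \<open>[]\<close> and \<open>[0]\<close> both have code 0. The lists
  coded below all have the length of \<open>cell_invariants\<close>.\<close>

lemma nat_list_code_inj:
  "length xs = length ys \<Longrightarrow> set xs \<subseteq> \<nat> \<Longrightarrow> set ys \<subseteq> \<nat> \<Longrightarrow>
    nat_list_code xs = nat_list_code ys \<Longrightarrow> xs = ys"
proof (induction xs ys rule: list_induct2)
  case (Cons x xs y ys)
  obtain k l where kl: "x = real k" "y = real l"
    using Cons.prems by (auto elim!: Nats_cases)
  obtain a b where ab: "nat_list_code xs = real a" "nat_list_code ys = real b"
    using Cons.prems nat_list_code_Nats[of xs] nat_list_code_Nats[of ys] by (auto elim!: Nats_cases)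
  have "(k + a)\<^sup>2 + k = (l + b)\<^sup>2 + l"
    using Cons.prems(3) unfolding nat_list_code.simps kl ab nat_pair_of_nat by (rule of_nat_eq_iff[THEN iffD1])
  then have "k = l" "a = b" using square_add_inj by blast+
  with Cons kl ab show ?case by simp
qed simp

text \<open>The divisibility form of Goedel's beta function: the pair \<open>a\<close>,
  \<open>b\<close> represents the set of all \<open>k\<close> whose modulus
  \<open>1 + (k + 1) * b\<close> divides \<open>a\<close>.\<close>

definition coded :: "real \<Rightarrow> real \<Rightarrow> real \<Rightarrow> bool"
  where "coded a b k \<longleftrightarrow> dvd_real (1 + nat_mult (k + 1) b) a"

lemma coded_of_nat [simp]: "coded (real a) (real b) (real k) \<longleftrightarrow> 1 + (k + 1) * b dvd a"
proof -
  have "1 + nat_mult (real k + 1) (real b) = real (1 + (k + 1) * b)"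
    by (metis nat_mult_of_nat of_nat_1 of_nat_add)
  then show ?thesis unfolding coded_def by (simp only: dvd_real_of_nat)
qed

text \<open>A common divisor is coprime to \<open>fact N\<close>, since each modulus is 1 modulo
  \<open>fact N\<close>. It divides \<open>(l - k) * fact N\<close>, hence \<open>l - k\<close>,
  which in turn divides \<open>fact N\<close>.\<close>

lemma goedel_moduli_coprime:
  fixes k l N :: nat
  assumes "k < l" "l < N"
  shows "coprime (1 + (k + 1) * fact N) (1 + (l + 1) * fact N :: nat)"
proof (rule coprimeI)
  fix d :: nat assume d: "d dvd 1 + (k + 1) * fact N" "d dvd 1 + (l + 1) * fact N"
  have "coprime d (fact N)"
  proof (rule coprimeI)
    fix c assume "c dvd d" "c dvd fact N"
    then have "c dvd 1 + (k + 1) * fact N" "c dvd (k + 1) * fact N"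
      using d(1) by (auto intro: dvd_trans)
    then show "is_unit c" by (metis dvd_add_left_iff)
  qed
  have "d dvd (1 + (l + 1) * fact N) - (1 + (k + 1) * fact N)" using d by (rule dvd_diff_nat[rotated])
  also have "(1 + (l + 1) * fact N) - (1 + (k + 1) * fact N) = (l - k) * fact N"
    by (simp add: diff_mult_distrib)
  finally have "d dvd l - k"
    using \<open>coprime d (fact N)\<close> coprime_dvd_mult_left_iff by blast
  also have "l - k dvd fact N" using assms by (intro dvd_fact) auto
  finally show "is_unit d" using \<open>coprime d (fact N)\<close> by (meson coprime_common_divisor dvd_refl)
qed

text \<open>Take for \<open>a\<close> the product of the moduli of \<open>F\<close>. Pairwise
  coprimality up to a bound for \<open>G\<close> prevents any other element of \<open>G\<close> from
  being coded; nothing is claimed outside \<open>G\<close>.\<close>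

lemma finite_set_coded:
  fixes F G :: "nat set"
  assumes "F \<subseteq> G" "finite G"
  shows "\<exists>a b :: nat. \<forall>k\<in>G. coded (real a) (real b) (real k) \<longleftrightarrow> k \<in> F"
proof -
  obtain N where N: "\<And>k. k \<in> G \<Longrightarrow> k < N" using assms(2) unfolding finite_nat_set_iff_bounded by auto
  define b where "b = (fact N :: nat)"
  define a where "a = (\<Prod>l\<in>F. 1 + (l + 1) * b)"
  have fin: "finite F" using assms finite_subset by blast
  have "1 + (k + 1) * b dvd a \<longleftrightarrow> k \<in> F" if k: "k \<in> G" for k
  proof
    assume dvd: "1 + (k + 1) * b dvd a"
    show "k \<in> F"
    proof (rule ccontr)
      assume "k \<notin> F"
      have "coprime (1 + (k + 1) * b) (1 + (l + 1) * b)" if "l \<in> F" for l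
      proof -
        have "k \<noteq> l" "l < N" "k < N" using that \<open>k \<notin> F\<close> N k assms(1) by auto
        then show ?thesis
          using goedel_moduli_coprime[of k l N] goedel_moduli_coprime[of l k N]
          unfolding b_def by (metis coprime_commute linorder_neqE_nat)
      qed
      then have "coprime (1 + (k + 1) * b) a" unfolding a_def by (intro prod_coprime_right)
      then have "is_unit (1 + (k + 1) * b)" using dvd by (meson coprime_common_divisor dvd_refl)
      then show False by (simp add: b_def)
    qed
  next
    assume "k \<in> F"
    then show "1 + (k + 1) * b dvd a" unfolding a_def using fin by (rule dvd_prodI[rotated])
  qed
  then show ?thesis unfolding coded_of_nat by blast
qed

section \<open>Definability of the coding functions\<close>

locale dvd_struct = ordered_group_struct +
  assumes dvd_rel_in: "(2, dvd_rel) \<in> rels M"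
begin

lemma dpred_dvd_real: "dfun M s \<Longrightarrow> dfun M t \<Longrightarrow> dpred M (\<lambda>e. dvd_real (s e) (t e))"
proof (rule dpred_subst2[where R = dvd_real])
  have "nth_default 0 [a, b] \<in> dvd_rel \<longleftrightarrow> dvd_real a b" for a b
  proof
    assume "nth_default 0 [a, b] \<in> dvd_rel"
    then obtain m d where eq: "nth_default 0 [a, b] = nth_default 0 [real m, real (d * m)]"
      unfolding dvd_rel_def by blast
    show "dvd_real a b"
      using fun_cong[OF eq, of 0] fun_cong[OF eq, of 1] by (auto simp: dvd_real_def)
  qed (auto simp: dvd_rel_def dvd_real_def)
  then show "dpred M (\<lambda>e. dvd_real (e i) (e j))" for i j
    using dpred_sat[of M "Rel dvd_rel [Var i, Var j]"] dvd_rel_in by (simp add: numeral_2_eq_2)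
qed

lemma dpred_Nats: "dfun M t \<Longrightarrow> dpred M (\<lambda>e. t e \<in> \<nat>)"
  unfolding Nats_iff_dvd_real by (rule dpred_dvd_real)

lemma dpred_Ints:
  assumes "dfun M t"
  shows "dpred M (\<lambda>e. t e \<in> \<int>)"
proof -
  have "x \<in> \<int> \<longleftrightarrow> x \<in> \<nat> \<or> - x \<in> \<nat>" for x :: real
  proof
    assume "x \<in> \<int>"
    then obtain k where k: "x = of_int k" by (auto elim: Ints_cases)
    show "x \<in> \<nat> \<or> - x \<in> \<nat>" by (cases k rule: int_cases2) (simp_all add: k)
  next
    assume "x \<in> \<nat> \<or> - x \<in> \<nat>"
    then have "x \<in> \<int> \<or> - x \<in> \<int>" using Nats_subset_Ints by blast
    then show "x \<in> \<int>" by simp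
  qed
  then show ?thesis
    by (simp only:) (intro dpred_disj dpred_Nats dfun_uminus assms)
qed

lemma dfun_floor:
  assumes "dfun M t"
  shows "dfun M (\<lambda>e. of_int \<lfloor>t e\<rfloor>)"
proof (rule dfunI)
  let ?t = "\<lambda>e. t (\<lambda>i. e (Suc i))"
  have t: "dfun M ?t" using assms by (rule dfun_Suc)
  show "dpred M (\<lambda>e. e 0 \<in> \<int> \<and> e 0 \<le> ?t e \<and> ?t e < e 0 + 1)"
    by (intro dpred_conj dpred_Ints dpred_le dpred_less dfun_add dfun_var dfun_const t)
  show "r = of_int \<lfloor>t e\<rfloor> \<longleftrightarrow> r \<in> \<int> \<and> r \<le> t e \<and> t e < r + 1" for r e
    by (auto elim!: Ints_cases simp: floor_eq_iff) (metis floor_unique)+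
qed

lemma dfun_nat_square:
  assumes "dfun M t"
  shows "dfun M (\<lambda>e. nat_square (t e))"
proof (rule dfunI[OF _ nat_square_iff])
  let ?t = "\<lambda>e. t (\<lambda>i. e (Suc i))"
  have t: "dfun M ?t" using assms by (rule dfun_Suc)
  have t': "dfun M (\<lambda>e. ?t (\<lambda>i. e (Suc i)))" using t by (rule dfun_Suc)
  show "dpred M (\<lambda>e. (?t e \<notin> \<nat> \<or> ?t e = 0) \<and> e 0 = 0 \<or>
      ?t e \<in> \<nat> \<and> ?t e \<noteq> 0 \<and> e 0 \<in> \<nat> \<and> dvd_real (?t e) (e 0 + ?t e) \<and>
      dvd_real (?t e + 1) (e 0 + ?t e) \<and>
      (\<forall>s. 0 < s \<and> dvd_real (?t e) s \<and> dvd_real (?t e + 1) s \<longrightarrow> e 0 + ?t e \<le> s))"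
    by (intro dpred_disj dpred_conj dpred_not dpred_imp dpred_all dpred_Nats dpred_dvd_real dpred_eq
        dpred_less dpred_le dfun_add dfun_var dfun_const t t')
qed

lemma dfun_nat_mult: "dfun M s \<Longrightarrow> dfun M t \<Longrightarrow> dfun M (\<lambda>e. nat_mult (s e) (t e))"
  unfolding nat_mult_def by (intro dfun_rat_scale dfun_diff dfun_nat_square dfun_add) simp_all

lemma dfun_nat_pair: "dfun M s \<Longrightarrow> dfun M t \<Longrightarrow> dfun M (\<lambda>e. nat_pair (s e) (t e))"
  unfolding nat_pair_def by (intro dfun_nat_square dfun_add)

lemma dpred_coded:
  "dfun M r \<Longrightarrow> dfun M s \<Longrightarrow> dfun M t \<Longrightarrow> dpred M (\<lambda>e. coded (r e) (s e) (t e))"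
  unfolding coded_def by (intro dpred_dvd_real dfun_add dfun_const dfun_nat_mult)

lemma dfun_nat_list_code:
  "(\<And>g. g \<in> set gs \<Longrightarrow> dfun M (\<lambda>e. g (v e))) \<Longrightarrow>
    dfun M (\<lambda>e. nat_list_code (map (\<lambda>g. g (v e)) gs))"
  by (induction gs) (auto intro: dfun_const dfun_nat_pair)

end

context cell_decomposition
begin

text \<open>The entries must be natural numbers to be coded: a floor is given by its positive and
  negative parts, and a sign is shifted to 0, 1 or 2. Any fixed enumeration of \<open>H\<close>
  serves.\<close>

definition cell_invariants :: "((nat \<Rightarrow> real) \<Rightarrow> real) list"
  where "cell_invariants = map (\<lambda>i x. max 0 (flr x i)) [0..<n] @ map (\<lambda>i x. max 0 (- flr x i)) [0..<n] @
    map (\<lambda>h x. sgn (h (frc x)) + 1) (SOME hs. set hs = H)"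

definition cell_code :: "(nat \<Rightarrow> real) \<Rightarrow> real"
  where "cell_code x = nat_list_code (map (\<lambda>g. g x) cell_invariants)"

lemma set_cell_invariants: "set cell_invariants =
    (\<lambda>i x. max 0 (flr x i)) ` {..<n} \<union> (\<lambda>i x. max 0 (- flr x i)) ` {..<n} \<union>
    (\<lambda>h x. sgn (h (frc x)) + 1) ` H"
proof -
  have "set (SOME hs. set hs = H) = H"
    using finite_list[OF finite_H] by (rule someI_ex)
  then show ?thesis by (auto simp: cell_invariants_def)
qed

lemma cell_invariant_Nats:
  assumes "g \<in> set cell_invariants"
  shows "g x \<in> \<nat>"
proof -
  have max: "max 0 (real_of_int k) \<in> \<nat>" for k
  proof -
    have "max 0 (real_of_int k) = real (nat k)" by (cases "k \<ge> 0") auto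
    then show ?thesis by simp
  qed
  have "max 0 (flr x i) \<in> \<nat>" "max 0 (- flr x i) \<in> \<nat>" for i
    using max[of "\<lfloor>x i\<rfloor>"] max[of "- \<lfloor>x i\<rfloor>"] by (simp_all add: flr_def)
  moreover have "sgn r + 1 \<in> \<nat>" for r :: real by (simp add: sgn_real_def)
  ultimately show ?thesis using assms by (auto simp: set_cell_invariants)
qed

lemma cell_code_Nats: "cell_code x \<in> \<nat>"
  unfolding cell_code_def by (rule nat_list_code_Nats) (auto simp: cell_invariant_Nats)

lemma cell_code_eqD:
  assumes "cell_code x = cell_code y" "x \<in> Rn n" "y \<in> Rn n"
  shows "flr x = flr y" "same_signs H (frc x) (frc y)"
proof -
  have "map (\<lambda>g. g x) cell_invariants = map (\<lambda>g. g y) cell_invariants"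
    using assms(1) unfolding cell_code_def
    by (intro nat_list_code_inj) (auto simp: cell_invariant_Nats)
  then have eq: "g x = g y" if "g \<in> set cell_invariants" for g
    using that by simp
  show "flr x = flr y"
  proof
    fix i
    show "flr x i = flr y i"
    proof (cases "i < n")
      case True
      then have "max 0 (flr x i) = max 0 (flr y i)" "max 0 (- flr x i) = max 0 (- flr y i)"
        using eq by (auto simp: set_cell_invariants)
      then show ?thesis by linarith
    qed (use assms(2,3) in \<open>simp add: Rn_iff flr_def\<close>)
  qed
  have "sgn (h (frc x)) + 1 = sgn (h (frc y)) + 1" if "h \<in> H" for h
    by (rule eq) (use that in \<open>simp add: set_cell_invariants\<close>)
  then show "same_signs H (frc x) (frc y)" by (simp add: same_signs_def)
qed

lemma same_cell_adjacent:
  assumes "cell_code x = cell_code y" "x \<in> Rn n" "y \<in> Rn n"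
  shows "adjacent H x y"
  using cell_code_eqD[OF assms] by (auto simp: adjacent_def same_signs_def frc_eq)

lemma finite_cell_codes: "finite (cell_code ` {x. \<forall>i<n. \<bar>x i\<bar> \<le> B})"
proof -
  \<comment> \<open>A floor exceeds the bound in absolute value by at most 1, and a shifted sign is
    at most 2; \<open>\<bar>B\<bar> + 2\<close> covers both.\<close>
  define K where "K = \<lceil>\<bar>B\<bar>\<rceil> + 2"
  have K: "\<bar>B\<bar> + 2 \<le> of_int K" unfolding K_def by linarith
  have vals: "g x \<in> real_of_int ` {0..K}"
    if "\<forall>i<n. \<bar>x i\<bar> \<le> B" and g: "g \<in> set cell_invariants" for g x
  proof -
    obtain m where m: "g x = real m" using cell_invariant_Nats[OF g] by (auto elim: Nats_cases)
    have "\<bar>flr x i\<bar> \<le> \<bar>B\<bar> + 1" if "i < n" for i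
      using \<open>\<forall>i<n. \<bar>x i\<bar> \<le> B\<close>[rule_format, OF that] unfolding flr_def by linarith
    then have "max 0 (flr x i) \<le> \<bar>B\<bar> + 2" "max 0 (- flr x i) \<le> \<bar>B\<bar> + 2" if "i < n" for i
      using that by (force simp: abs_le_iff)+
    moreover have "sgn r + 1 \<le> \<bar>B\<bar> + 2" for r by (simp add: sgn_real_def)
    ultimately have "g x \<le> \<bar>B\<bar> + 2" using g unfolding set_cell_invariants by auto
    then have "int m \<in> {0..K}" using m K by simp
    then show ?thesis unfolding m by (metis image_eqI of_int_of_nat_eq)
  qed
  have "cell_code ` {x. \<forall>i<n. \<bar>x i\<bar> \<le> B} \<subseteq>
      nat_list_code ` {xs. set xs \<subseteq> real_of_int ` {0..K} \<and> length xs = length cell_invariants}"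
  proof
    fix k assume "k \<in> cell_code ` {x. \<forall>i<n. \<bar>x i\<bar> \<le> B}"
    then obtain x where "\<forall>i<n. \<bar>x i\<bar> \<le> B" "k = nat_list_code (map (\<lambda>g. g x) cell_invariants)"
      by (auto simp: cell_code_def)
    with vals[of x] show "k \<in> nat_list_code ` {xs. set xs \<subseteq> real_of_int ` {0..K} \<and> length xs = length cell_invariants}"
      by (intro image_eqI[of _ _ "map (\<lambda>g. g x) cell_invariants"]) auto
  qed
  then show ?thesis
    by (rule finite_subset) (intro finite_imageI finite_lists_length_eq, simp)
qed

section \<open>Bounded definable sets\<close>

lemma bounded_definable:
  assumes "bounded_in n E"
  shows "definable R_less_add n E"
proof -
  obtain B where B: "\<And>x. x \<in> E \<Longrightarrow> L2_set x {..<n} \<le> B"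
    using assms by (auto simp: bounded_in_def)
  have "\<bar>x i\<bar> \<le> B" if "x \<in> E" "i < n" for x i
  proof -
    have "\<bar>x i\<bar> \<le> L2_set (\<lambda>i. \<bar>x i\<bar>) {..<n}"
      using that by (intro member_le_L2_set) auto
    also have "\<dots> = L2_set x {..<n}" by (simp add: L2_set_def)
    finally show ?thesis using B[OF that(1)] by simp
  qed
  then have "finite (cell_code ` E)"
    by (intro finite_subset[OF _ finite_cell_codes[of B]]) auto
  \<comment> \<open>One representative for each of the finitely many cells meeting \<open>E\<close>.
    Only their floors occur in the resulting formula, as constants, so it can be written with order
    and addition.\<close>
  then obtain Y where Y: "Y \<subseteq> E" "finite Y" "cell_code ` E = cell_code ` Y"
    using finite_subset_image[of "cell_code ` E" cell_code E] by auto
  have "trunc n e \<in> E \<longleftrightarrow>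
      (\<exists>y\<in>Y. \<forall>h\<in>H. sgn (h (\<lambda>i. trunc n e i - flr y i)) = sgn (h (frc y)))" for e
  proof
    assume e: "trunc n e \<in> E"
    then obtain y where y: "y \<in> Y" "cell_code (trunc n e) = cell_code y" using Y(3) by (metis imageE imageI)
    have "y \<in> Rn n" using y Y(1) E_subset by blast
    from cell_code_eqD[OF y(2) trunc_in_Rn this] y(1)
    show "\<exists>y\<in>Y. \<forall>h\<in>H. sgn (h (\<lambda>i. trunc n e i - flr y i)) = sgn (h (frc y))"
      by (intro bexI[of _ y]) (simp_all add: frc_eq same_signs_def)
  next
    assume "\<exists>y\<in>Y. \<forall>h\<in>H. sgn (h (\<lambda>i. trunc n e i - flr y i)) = sgn (h (frc y))"
    then obtain y where y: "y \<in> Y" "\<And>h. h \<in> H \<Longrightarrow> sgn (h (\<lambda>i. trunc n e i - flr y i)) = sgn (h (frc y))"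
      by blast
    have "y \<in> E" "y \<in> Rn n" using y(1) Y(1) E_subset by blast+
    with cell_of_signs[OF \<open>y \<in> Rn n\<close> trunc_in_Rn y(2)] show "trunc n e \<in> E"
      using saturated trunc_in_Rn by blast
  qed
  moreover have "dfun R_less_add (\<lambda>e. trunc n e i - c)" for i c
    by (cases "i < n") (simp_all add: trunc_def R_less_add.dfun_diff dfun_var dfun_const)
  then have "dfun R_less_add (\<lambda>e. h (\<lambda>i. trunc n e i - flr y i))" if "h \<in> H" for h y
    by (rule R_less_add.dfun_aff[OF aff_H[OF that], where v = "\<lambda>e i. trunc n e i - flr y i"])
  then have "dpred R_less_add (\<lambda>e. \<exists>y\<in>Y. \<forall>h\<in>H. sgn (h (\<lambda>i. trunc n e i - flr y i)) = sgn (h (frc y)))"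
    by (intro dpred_bex_finite Y(2) dpred_ball_finite finite_H dpred_eq R_less_add.dfun_sgn dfun_const)
  ultimately show ?thesis
    using E_subset by (simp add: definable_iff_dpred)
qed

text \<open>The set coded by \<open>a\<close>, \<open>b\<close> is tested only on points of the box
  of radius \<open>B\<close>, because a code can be prescribed on finitely many cells only. The
  equivalence covers adjacency in both directions.\<close>

definition closed_under_adjacency :: "real \<Rightarrow> real \<Rightarrow> real \<Rightarrow> bool"
  where "closed_under_adjacency B a b \<longleftrightarrow> (\<forall>u\<in>Rn n. \<forall>v\<in>Rn n. u \<in> E \<and> v \<in> E \<and>
    (\<forall>i<n. - B \<le> u i \<and> u i \<le> B) \<and> (\<forall>i<n. - B \<le> v i \<and> v i \<le> B) \<and> adjacent H u v \<longrightarrow>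
    (coded a b (cell_code u) \<longleftrightarrow> coded a b (cell_code v)))"

lemma closed_under_adjacencyD:
  assumes "closed_under_adjacency B a b" "u \<in> E" "v \<in> E" "adjacent H u v"
    "\<And>i. i < n \<Longrightarrow> \<bar>u i\<bar> \<le> B" "\<And>i. i < n \<Longrightarrow> \<bar>v i\<bar> \<le> B"
  shows "coded a b (cell_code u) \<longleftrightarrow> coded a b (cell_code v)"
proof -
  have "\<forall>i<n. - B \<le> u i \<and> u i \<le> B" "\<forall>i<n. - B \<le> v i \<and> v i \<le> B"
    using assms(5,6) by (simp_all add: abs_le_iff minus_le_iff)
  with assms(1-4) E_subset show ?thesis
    unfolding closed_under_adjacency_def by blast
qed

lemma closed_under_adjacency_mono:
  "closed_under_adjacency B a b \<Longrightarrow> C \<le> B \<Longrightarrow> closed_under_adjacency C a b"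
  unfolding closed_under_adjacency_def by (smt (verit))

text \<open>\<open>B\<close> is chosen to bound all coordinates of a chain from \<open>x\<close> to
  \<open>z\<close>; membership then passes along the chain without leaving the box.\<close>

lemma chained_imp_coded:
  assumes "chained x z" "x \<in> E"
  shows "\<exists>B. \<forall>a b. closed_under_adjacency B a b \<and> coded a b (cell_code x) \<longrightarrow> coded a b (cell_code z)"
  using assms(1) unfolding chained_def
proof (induction rule: rtranclp_induct)
  case base
  show ?case by blast
next
  case (step y z)
  then obtain B where B: "\<And>a b. closed_under_adjacency B a b \<Longrightarrow> coded a b (cell_code x) \<Longrightarrow>
      coded a b (cell_code y)"
    by blast
  define C where "C = max B (\<Sum>i<n. \<bar>y i\<bar> + \<bar>z i\<bar>)"
  have bound: "\<bar>y i\<bar> \<le> C" "\<bar>z i\<bar> \<le> C" if "i < n" for i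
  proof -
    have "\<bar>y i\<bar> + \<bar>z i\<bar> \<le> (\<Sum>i<n. \<bar>y i\<bar> + \<bar>z i\<bar>)"
      using that by (intro member_le_sum) auto
    then show "\<bar>y i\<bar> \<le> C" "\<bar>z i\<bar> \<le> C" unfolding C_def by linarith+
  qed
  have "coded a b (cell_code z)" if ab: "closed_under_adjacency C a b" "coded a b (cell_code x)" for a b
  proof -
    have "closed_under_adjacency B a b"
      using ab(1) by (rule closed_under_adjacency_mono) (simp add: C_def)
    then have "coded a b (cell_code y)" using B ab(2) by blast
    moreover have "coded a b (cell_code y) \<longleftrightarrow> coded a b (cell_code z)"
      using closed_under_adjacencyD[OF ab(1), of y z] closed_under_adjacencyD[OF ab(1), of z y]
        step(2) bound by blast
    ultimately show ?thesis by simp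
  qed
  then show ?case by blast
qed

text \<open>For every \<open>B\<close> the codes of the cells in the box that meet the class of
  \<open>x\<close> form a finite set. A code for it respects adjacency and omits the cell of
  \<open>z\<close>.\<close>

lemma separated_if_not_chained:
  assumes x: "x \<in> E" and z: "z \<in> E" and not: "\<not> chained x z"
  shows "\<exists>a\<in>\<nat>. \<exists>b\<in>\<nat>. closed_under_adjacency B a b \<and> coded a b (cell_code x) \<and>
    \<not> coded a b (cell_code z)"
proof -
  \<comment> \<open>\<open>x\<close> and \<open>z\<close> may lie outside the box; adding them makes
    the code decide their cells correctly as well.\<close>
  define D where "D = {u. \<forall>i<n. \<bar>u i\<bar> \<le> B} \<union> {x, z}"
  define G where "G = {k :: nat. real k \<in> cell_code ` D}"
  define F where "F = {k :: nat. real k \<in> cell_code ` {u \<in> D. u \<in> E \<and> chained x u}}"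
  have "cell_code ` D = cell_code ` {u. \<forall>i<n. \<bar>u i\<bar> \<le> B} \<union> {cell_code x, cell_code z}"
    by (auto simp: D_def)
  then have "finite (cell_code ` D)" using finite_cell_codes by simp
  then have "finite (real -` (cell_code ` D))" by (rule finite_vimageI) (simp add: inj_on_def)
  then have "finite G" by (simp add: G_def vimage_def)
  moreover have "F \<subseteq> G" by (auto simp: F_def G_def)
  ultimately obtain a b :: nat where ab: "\<And>k. k \<in> G \<Longrightarrow> coded (real a) (real b) (real k) \<longleftrightarrow> k \<in> F"
    using finite_set_coded[of F G] by blast
  have coded: "coded (real a) (real b) (cell_code u) \<longleftrightarrow> chained x u" if u: "u \<in> D" "u \<in> E" for u
  proof -
    obtain k where k: "cell_code u = real k" using cell_code_Nats by (auto elim: Nats_cases)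
    have "k \<in> G" unfolding G_def mem_Collect_eq k[symmetric] using u(1) by (rule imageI)
    then have "coded (real a) (real b) (cell_code u) \<longleftrightarrow> k \<in> F"
      unfolding k by (rule ab)
    also have "\<dots> \<longleftrightarrow> chained x u"
    proof
      assume "k \<in> F"
      then obtain v where v: "real k = cell_code v" "v \<in> E" "chained x v" by (auto simp: F_def)
      \<comment> \<open>A code identifies only the cell, so \<open>v\<close> may differ from
        \<open>u\<close>. Points of one cell are adjacent, so the class is a union of cells and the
        choice of \<open>v\<close> is harmless.\<close>
      have "adjacent H v u"
        using same_cell_adjacent[of v u] v(1,2) k u(2) E_subset by auto
      then have "chained v u" using chained_step v(2) u(2) by blast
      with v(3) show "chained x u" by (rule chained_trans)
    next
      assume "chained x u"
      with u show "k \<in> F" unfolding F_def mem_Collect_eq k[symmetric] by blast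
    qed
    finally show ?thesis .
  qed
  have "closed_under_adjacency B (real a) (real b)"
    unfolding closed_under_adjacency_def
  proof (intro ballI impI)
    fix u v assume uv: "u \<in> E \<and> v \<in> E \<and> (\<forall>i<n. - B \<le> u i \<and> u i \<le> B) \<and>
      (\<forall>i<n. - B \<le> v i \<and> v i \<le> B) \<and> adjacent H u v"
    then have D: "u \<in> D" "v \<in> D" by (auto simp: D_def abs_le_iff minus_le_iff)
    have "chained u v" "chained v u" using uv chained_step by blast+
    then have "chained x u \<longleftrightarrow> chained x v" using chained_trans by blast
    with coded[OF D(1)] coded[OF D(2)] uv
    show "coded (real a) (real b) (cell_code u) \<longleftrightarrow> coded (real a) (real b) (cell_code v)" by blast
  qed
  moreover have "x \<in> D" "z \<in> D" by (auto simp: D_def)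
  moreover have "chained x x" by (simp add: chained_def)
  ultimately show ?thesis using coded x z not by (meson of_nat_in_Nats)
qed

text \<open>This turns a transitive closure into quantification over numbers: a chain fits into some
  box, whereas without a chain every box admits a separating code.\<close>

lemma chained_iff_coded:
  assumes "x \<in> E" "z \<in> E"
  shows "chained x z \<longleftrightarrow> (\<exists>B. \<forall>a b. a \<in> \<nat> \<and> b \<in> \<nat> \<and> closed_under_adjacency B a b \<and>
    coded a b (cell_code x) \<longrightarrow> coded a b (cell_code z))"
  using chained_imp_coded[OF _ assms(1), of z] separated_if_not_chained[OF assms] by blast

section \<open>Definability of the components\<close>

lemma dfun_cell_code:
  assumes "dvd_struct M" "\<And>i. dfun M (\<lambda>e. v e i)"
  shows "dfun M (\<lambda>e. cell_code (v e))"
proof -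
  interpret dvd_struct M by (rule assms(1))
  have flr: "dfun M (\<lambda>e. flr (v e) i)" for i
    unfolding flr_def by (rule dfun_floor) (rule assms(2))
  have frc: "dfun M (\<lambda>e. frc (v e) i)" for i
    unfolding frc_eq by (rule dfun_diff[OF assms(2) flr])
  have max: "dfun M (\<lambda>e. max 0 (t e))" if "dfun M t" for t
    unfolding max_def by (intro dfun_if dpred_le dfun_const that)
  have "dfun M (\<lambda>e. h (frc (v e)))" if "h \<in> H" for h
    by (rule dfun_aff[OF aff_H[OF that], where v = "\<lambda>e. frc (v e)", OF frc])
  then have "dfun M (\<lambda>e. sgn (h (frc (v e))) + 1)" if "h \<in> H" for h
    using that by (intro dfun_add dfun_sgn dfun_const)
  moreover have "dfun M (\<lambda>e. max 0 (flr (v e) i))" "dfun M (\<lambda>e. max 0 (- flr (v e) i))" for i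
    using max[OF flr] max[OF dfun_uminus[OF flr]] .
  ultimately have "dfun M (\<lambda>e. g (v e))" if "g \<in> set cell_invariants" for g
    using that unfolding set_cell_invariants by auto
  then show ?thesis
    unfolding cell_code_def by (rule dfun_nat_list_code)
qed

lemma dpred_adjacent:
  assumes "dvd_struct M" "\<And>i. dfun M (\<lambda>e. v e i)" "\<And>i. dfun M (\<lambda>e. w e i)"
  shows "dpred M (\<lambda>e. adjacent H (v e) (w e))"
proof -
  interpret dvd_struct M by (rule assms(1))
  have flr: "dfun M (\<lambda>e. flr (w e) i)" for i
    unfolding flr_def by (rule dfun_floor) (rule assms(3))
  have "dfun M (\<lambda>e. frc (w e) i)" "dfun M (\<lambda>e. v e i - flr (w e) i)" for i
    unfolding frc_eq by (intro dfun_diff assms flr)+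
  then have "dfun M (\<lambda>e. h (frc (w e)))" "dfun M (\<lambda>e. h (\<lambda>i. v e i - flr (w e) i))" if "h \<in> H" for h
    using dfun_aff[OF aff_H[OF that], where v = "\<lambda>e. frc (w e)"]
      dfun_aff[OF aff_H[OF that], where v = "\<lambda>e i. v e i - flr (w e) i"] by blast+
  then show ?thesis
    unfolding adjacent_def
    by (intro dpred_ball_finite finite_H dpred_disj dpred_eq dfun_sgn dfun_const)
qed

lemma dfun_trunc: "dfun M (\<lambda>e. trunc k (\<lambda>j. e (f j)) i)"
  by (cases "i < k") (simp_all add: trunc_def dfun_var dfun_const)

lemma definable_chained:
  assumes M: "dvd_struct M" and E: "definable M n E" and x: "x \<in> E"
  shows "definable M n {z \<in> E. chained x z}"
proof -
  interpret dvd_struct M by (rule M)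
  have memE: "dpred M (\<lambda>e. trunc n (\<lambda>j. e (f j)) \<in> E)" if "inj f" for f
    using E that by (auto simp: definable_iff_dpred intro: dpred_inj)
  have code: "dfun M (\<lambda>e. cell_code (trunc n (\<lambda>j. e (f j))))" for f
    by (rule dfun_cell_code[OF M dfun_trunc])
  have adj: "dpred M (\<lambda>e. adjacent H (trunc n (\<lambda>j. e (f j))) (trunc n (\<lambda>j. e (g j))))" for f g
    by (rule dpred_adjacent[OF M dfun_trunc dfun_trunc])
  \<comment> \<open>As \<open>x\<close> is fixed, \<open>cell_code x\<close> enters as a real
    parameter. The points \<open>u\<close> and \<open>v\<close> in the closure condition are
    quantified coordinate by coordinate.\<close>
  have "dpred M (\<lambda>e. \<exists>B. \<forall>a b. a \<in> \<nat> \<and> b \<in> \<nat> \<and> closed_under_adjacency B a b \<and>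
    coded a b (cell_code x) \<longrightarrow> coded a b (cell_code (trunc n e)))"
    unfolding closed_under_adjacency_def
    by (intro dpred_ex dpred_all dpred_block_all dpred_all_less dpred_imp dpred_iff dpred_conj
        dpred_Nats dpred_le dpred_coded code adj memE dfun_trunc dfun_uminus dfun_var dfun_const)
      (simp_all add: inj_def)
  moreover have "dpred M (\<lambda>e. trunc n e \<in> E)" using E by (simp add: definable_iff_dpred)
  ultimately have "dpred M (\<lambda>e. trunc n e \<in> E \<and> (\<exists>B. \<forall>a b. a \<in> \<nat> \<and> b \<in> \<nat> \<and>
    closed_under_adjacency B a b \<and> coded a b (cell_code x) \<longrightarrow> coded a b (cell_code (trunc n e))))"
    by (rule dpred_conj[rotated])
  moreover have "trunc n e \<in> {z \<in> E. chained x z} \<longleftrightarrow> trunc n e \<in> E \<and>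
    (\<exists>B. \<forall>a b. a \<in> \<nat> \<and> b \<in> \<nat> \<and> closed_under_adjacency B a b \<and> coded a b (cell_code x) \<longrightarrow>
      coded a b (cell_code (trunc n e)))" for e
    using chained_iff_coded[OF x] by blast
  ultimately show ?thesis
    using E_subset by (auto simp: definable_iff_dpred)
qed

end

lemma (in integer_expansion) definable_cell_decomposition:
  assumes "definable M n E"
  shows "\<exists>H. cell_decomposition n H E"
proof -
  obtain H where H: "finite H" "\<forall>h\<in>H. aff h"
    "\<And>x y. x \<in> Rn n \<Longrightarrow> y \<in> Rn n \<Longrightarrow> flr x = flr y \<Longrightarrow> same_signs H (frc x) (frc y) \<Longrightarrow> x \<in> E \<Longrightarrow> y \<in> E"
    using definable_determined_by_signs[OF assms] by blast
  \<comment> \<open>The coordinate functions are adjoined to meet \<open>coord_H\<close>; enlarging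
    the set only strengthens \<open>same_signs\<close>, so saturation persists.\<close>
  let ?H = "H \<union> (\<lambda>i x. x i) ` {..<n} \<union> (\<lambda>i x. x i - 1) ` {..<n}"
  have sub: "E \<subseteq> Rn n" using assms by (simp add: definable_iff_dpred)
  have "cell_decomposition n ?H E"
  proof
    show "finite ?H" using H(1) by simp
    show "aff h" if "h \<in> ?H" for h
      using that H(2) by (auto intro: aff_var aff_diff aff_const)
    show "y \<in> E" if "x \<in> E" "y \<in> Rn n" "flr x = flr y" "same_signs ?H (frc x) (frc y)" for x y
      using H(3)[of x y] that sub by (auto simp: same_signs_def)
  qed (use sub in auto)
  then show ?thesis by blast
qed

theorem proposition1p8:
  fixes \<A> :: "(nat \<times> (nat \<Rightarrow> real) set) set" and M :: real_struct
  assumes "\<forall>(k, S) \<in> \<A>. S \<subseteq> Nn k"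
    and "M = expand R_less_add_dvd \<A>"
  shows "(\<forall>n E. definable M n E \<and> bounded_in n E \<longrightarrow> definable R_less_add n E) \<and>
    (\<forall>n E. definable M n E \<and> connectedin (Euclidean_space n) E \<longrightarrow>
      (\<forall>x\<in>E. \<forall>y\<in>E. \<exists>a b \<gamma>. path_joining n E a b \<gamma> x y \<and> definable_path R_less_add n a b \<gamma>)) \<and>
    component_closed M"
proof -
  \<comment> \<open>Divisibility has two roles: as a set of pairs of naturals it is subject to the
    elimination like the members of \<open>\<A>\<close>, and through \<open>dvd_struct\<close> it
    supplies the arithmetic for coding.\<close>
  have "dvd_rel \<subseteq> Nn 2"
    by (auto simp: dvd_rel_def Nn_def Rn_iff nth_default_beyond less_2_cases_iff)
  then interpret integer_expansion M
    using assms by unfold_locales (auto simp: expand_def R_less_add_dvd_def)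
  have M: "dvd_struct M"
    using assms(2) by unfold_locales (auto simp: expand_def R_less_add_dvd_def)
  show ?thesis
  proof (intro conjI allI impI ballI; (elim conjE)?)
    fix n E assume "definable M n E" "bounded_in n E"
    then show "definable R_less_add n E"
      using definable_cell_decomposition cell_decomposition.bounded_definable by blast
  next
    fix n E x y assume "definable M n E" "connectedin (Euclidean_space n) E" "x \<in> E" "y \<in> E"
    then have "joined n E x y"
      using definable_cell_decomposition cell_decomposition.connected_joined by blast
    then show "\<exists>a b \<gamma>. path_joining n E a b \<gamma> x y \<and> definable_path R_less_add n a b \<gamma>"
      by (simp add: joined_def)
  next
    show "component_closed M"
      unfolding component_closed_def
    proof (intro allI impI)
      fix n E C
      assume E: "definable M n E" and C: "C \<in> connected_components_of (subtopology (Euclidean_space n) E)"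
      obtain H where "cell_decomposition n H E" using definable_cell_decomposition[OF E] by blast
      then interpret cell_decomposition n H E .
      obtain x where x: "x \<in> C"
        using nonempty_connected_components_of[OF C] by blast
      then have "C = {z \<in> E. chained x z}" using component_eq_chained[OF C] by blast
      moreover from this x have "x \<in> E" by blast
      ultimately show "definable M n C" using definable_chained[OF M E] by simp
    qed
  qed
qed

end
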